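(* Let $\Bbbk$ be an algebraically closed field of characteristic zero, $q\in\Bbbk$ nonzero and not a root of unity, $R=\Bbbk\langle x,y : yx=qxy+1\rangle$, $\mu\in\Bbbk^*$, and let $\sigma$ be the automorphism of $R$ with $\sigma(x)=\mu^{-1}x$, $\sigma(y)=\mu y$. Let $\delta=I_w+\eta+\xi\in\mathrm{Der}_\sigma(R)$ be the decomposition of a $\sigma$-derivation $\delta$ along $\mathrm{Der}_\sigma(R)=\mathrm{Inn}_\sigma(R)\oplus\mathcal H_\mu\oplus\mathcal P_\mu$, where $I_w\in\mathrm{Inn}_\sigma(R)$, $\eta\in\mathcal H_\mu$ and $\xi\in\mathcal P_\mu$ (spaces defined in the context). Then $$\mathrm{Aut}_\delta^\sigma(R)=\mathrm{Aut}_{I_w}^\sigma(R)\cap\mathrm{Aut}_\eta^\sigma(R)\cap\mathrm{Aut}_\xi^\sigma(R),$$ where the zero components are omitted from the intersection. Moreover: (1) $\mathrm{Aut}_\eta^\sigma(R)=\mathrm{Aut}(R)$. (2) If $\xi\ne0$, then $\xi$ is of the form $\xi(x)=b(y)$, $\xi(y)=a(x)$ with $a(x)\in\Bbbk[x]$, $b(y)\in\Bbbk[y]$, and its isotropy group is isomorphic to $\mathbb Z_D$, where $D$ is the greatest common divisor of all the numbers $e+1$ with $e$ an exponent of a monomial of $a(x)$ or of $b(y)$. (3) The isotropy group of the inner component $I_w$ is described as follows. Write $w=\sum_{i,j}c_{(i,j)}x^iy^j$, $S=\{j-i\in\mathbb Z : c_{(i,j)}\ne0\}$ and $c=\gcd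 S$. An automorphism $\rho_\beta\neq\mathrm{id}$ commutes with $I_w$ if and only if $\beta^{c}=1$. The isotropy group of $I_w$ is isomorphic to: $\Bbbk^*$ if $w=\sum_i c_{(i,i)}x^iy^i$ (with the convention $\gcd(0,0)=0$); $\mathbb Z_c$ if $c=\gcd S\in\mathbb N\setminus\{0,1\}$; and $\{\mathrm{id}\}$ if $\gcd S=1$. In particular, $\mathrm{Aut}_\delta^\sigma(R)=\mathrm{Aut}_{I_w}^\sigma(R)\cap\mathrm{Aut}_\xi^\sigma(R)$.
   Context: A $\sigma$-derivation of $R$ is a $\Bbbk$-linear map $\delta:R\to R$ with $\delta(ab)=\delta(a)b+\sigma(a)\delta(b)$ for all $a,b\in R$; $\mathrm{Der}_\sigma(R)$ is the vector space of all of them. Since $q$ is not a root of unity, every automorphism of $R$ is of the form $\rho_\beta$, $\beta\in\Bbbk^*$, with $\rho_\beta(x)=\beta^{-1}x$, $\rho_\beta(y)=\beta y$; all of them commute with $\sigma$. The isotropy group of $\delta\in\mathrm{Der}_\sigma(R)$ is $\mathrm{Aut}_\delta^\sigma(R)=\{\rho\in\mathrm{Aut}(R):\rho\delta=\delta\rho\}$. $\mathbb Z_n$ is the cyclic group of order $n$. For $w\in R$, $I_w(a)=wa-\sigma(a)w$ for $a\in R$ (the inner $\sigma$-derivation induced by $w$), and $\mathrm{Inn}_\sigma(R)=\{I_w:w\in R\}\subseteq\mathrm{Der}_\sigma(R)$. Let $h=1-yx\in R$. For an integer $r\ge0$, $H_r$ denotes the $\sigma$-derivation of $R$ given on generators by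 $H_r(x)=h^rx$, $H_r(y)=\mu^{-1}(q^{-1}h)^ry$. Define $\mathcal H_\mu=\Bbbk H_r$ if $\mu=q^{-r}$ for some $r\ge0$, and $\mathcal H_\mu=0$ otherwise. If $\mu=q$, then for integers $i,j\ge0$ let $X_i,Y_j$ be the $\sigma$-derivations with $X_i(x)=y^i$, $X_i(y)=0$, $Y_j(x)=0$, $Y_j(y)=x^j$, and let $\mathcal P_\mu=\big(\bigoplus_{i\ge0}\Bbbk X_i\big)\oplus\big(\bigoplus_{j\ge0}\Bbbk Y_j\big)$. If $\mu\ne q$, let $\mathcal P_\mu=0$. One has $\mathrm{Der}_\sigma(R)=\mathrm{Inn}_\sigma(R)\oplus\mathcal H_\mu\oplus\mathcal P_\mu$, each summand being stable under conjugation by $\mathrm{Aut}(R)$.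
   Formalization: As printed, H_r is not a σ-derivation (for r=0, μ=1 the map x→x, y→y violates yx=qxy+1); the formal version takes h=1-(1-q)yx instead of h=1-yx, and H_r(y)=-μ^{-1}(q^{-1}h)^r y with a minus sign. *)

theory Defs
  imports
    "HOL-Library.Poly_Mapping"
    "HOL-Computational_Algebra.Polynomial"
    "HOL-Algebra.QuotRing"
    "HOL-Algebra.Bij"
    "HOL-Algebra.Elementary_Groups"
    "HOL-Algebra.Algebraic_Closure_Type"
begin

section \<open>The free algebra on two generators\<close>

text \<open>Words form a (noncommutative) additive monoid, so that the finitely supported functions
  from words to the field, with the convolution product of \<open>Poly_Mapping\<close>, are the free algebra.\<close>

datatype gen = GX | GY

datatype word = Word "gen list"

instantiation word :: monoid_add
begin

definition zero_word :: word where "zero_word = Word []"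

fun plus_word :: "word \<Rightarrow> word \<Rightarrow> word" where
  "plus_word (Word u) (Word v) = Word (u @ v)"

instance
proof
  fix a b c :: word
  show "a + b + c = a + (b + c)" by (cases a; cases b; cases c) simp
  show "0 + a = a" by (cases a) (simp add: zero_word_def)
  show "a + 0 = a" by (cases a) (simp add: zero_word_def)
qed

end

type_synonym 'k free = "word \<Rightarrow>\<^sub>0 'k"

abbreviation free_const :: "'k \<Rightarrow> ('k::field) free" where
  "free_const c \<equiv> Poly_Mapping.single 0 c"

abbreviation free_x :: "('k::field) free" where
  "free_x \<equiv> Poly_Mapping.single (Word [GX]) 1"

abbreviation free_y :: "('k::field) free" where
  "free_y \<equiv> Poly_Mapping.single (Word [GY]) 1"

abbreviation free_ring :: "('k::field) free ring" where
  "free_ring \<equiv> ring_of_type_algebra"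


section \<open>The algebra \<open>R = \<bbbk>\<langle>x, y : yx = qxy + 1\<rangle>\<close>\<close>

definition qweyl_ideal :: "'k::field \<Rightarrow> 'k free set" where
  "qweyl_ideal q =
     genideal free_ring {free_y * free_x - (free_const q * free_x * free_y + 1)}"

definition qweyl :: "'k::field \<Rightarrow> 'k free set ring" where
  "qweyl q = free_ring Quot (qweyl_ideal q)"

definition qcls :: "'k::field \<Rightarrow> 'k free \<Rightarrow> 'k free set" where
  "qcls q f = qweyl_ideal q +>\<^bsub>free_ring\<^esub> f"

definition Rx :: "'k::field \<Rightarrow> 'k free set" where
  "Rx q = qcls q free_x"

definition Ry :: "'k::field \<Rightarrow> 'k free set" where
  "Ry q = qcls q free_y"

definition smul :: "'k::field \<Rightarrow> 'k \<Rightarrow> 'k free set \<Rightarrow> 'k free set" where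
  "smul q c a = qcls q (free_const c) \<otimes>\<^bsub>qweyl q\<^esub> a"

definition klinear :: "'k::field \<Rightarrow> ('k free set \<Rightarrow> 'k free set) \<Rightarrow> bool" where
  "klinear q f \<longleftrightarrow>
     (\<forall>a\<in>carrier (qweyl q). \<forall>b\<in>carrier (qweyl q).
        f (a \<oplus>\<^bsub>qweyl q\<^esub> b) = f a \<oplus>\<^bsub>qweyl q\<^esub> f b) \<and>
     (\<forall>c. \<forall>a\<in>carrier (qweyl q). f (smul q c a) = smul q c (f a))"

definition poly_at :: "'k::field \<Rightarrow> 'k poly \<Rightarrow> 'k free set \<Rightarrow> 'k free set" where
  "poly_at q p a = (\<Oplus>\<^bsub>qweyl q\<^esub> n\<in>{..degree p}. smul q (Polynomial.coeff p n) (a [^]\<^bsub>qweyl q\<^esub> n))"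

definition xy_sum :: "'k::field \<Rightarrow> (nat \<times> nat \<Rightarrow>\<^sub>0 'k) \<Rightarrow> 'k free set" where
  "xy_sum q c = (\<Oplus>\<^bsub>qweyl q\<^esub> p\<in>Poly_Mapping.keys c.
     smul q (Poly_Mapping.lookup c p)
       (Rx q [^]\<^bsub>qweyl q\<^esub> fst p \<otimes>\<^bsub>qweyl q\<^esub> Ry q [^]\<^bsub>qweyl q\<^esub> snd p))"


section \<open>Automorphisms\<close>

text \<open>All self-maps of \<open>R\<close> are taken extensional on the carrier, so that equality of functions
  is equality of maps on \<open>R\<close>.\<close>

definition Aut :: "'k::field \<Rightarrow> ('k free set \<Rightarrow> 'k free set) set" where
  "Aut q = {f \<in> Bij (carrier (qweyl q)). f \<in> ring_hom (qweyl q) (qweyl q) \<and> klinear q f}"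

definition Id_R :: "'k::field \<Rightarrow> 'k free set \<Rightarrow> 'k free set" where
  "Id_R q = (\<lambda>a\<in>carrier (qweyl q). a)"

definition rho :: "'k::field \<Rightarrow> 'k \<Rightarrow> 'k free set \<Rightarrow> 'k free set" where
  "rho q \<beta> = (THE f. f \<in> Aut q \<and> f (Rx q) = smul q (inverse \<beta>) (Rx q) \<and> f (Ry q) = smul q \<beta> (Ry q))"


section \<open>Skew derivations\<close>

text \<open>The twist \<open>\<sigma>\<close> is \<open>rho q \<mu>\<close>.\<close>

definition Der :: "'k::field \<Rightarrow> 'k \<Rightarrow> ('k free set \<Rightarrow> 'k free set) set" where
  "Der q \<mu> = {d \<in> carrier (qweyl q) \<rightarrow>\<^sub>E carrier (qweyl q). klinear q d \<and>
     (\<forall>a\<in>carrier (qweyl q). \<forall>b\<in>carrier (qweyl q).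
        d (a \<otimes>\<^bsub>qweyl q\<^esub> b) = d a \<otimes>\<^bsub>qweyl q\<^esub> b \<oplus>\<^bsub>qweyl q\<^esub> rho q \<mu> a \<otimes>\<^bsub>qweyl q\<^esub> d b)}"

definition zero_map :: "'k::field \<Rightarrow> 'k free set \<Rightarrow> 'k free set" where
  "zero_map q = (\<lambda>a\<in>carrier (qweyl q). \<zero>\<^bsub>qweyl q\<^esub>)"

definition Inner :: "'k::field \<Rightarrow> 'k \<Rightarrow> 'k free set \<Rightarrow> 'k free set \<Rightarrow> 'k free set" where
  "Inner q \<mu> w = (\<lambda>a\<in>carrier (qweyl q).
     w \<otimes>\<^bsub>qweyl q\<^esub> a \<ominus>\<^bsub>qweyl q\<^esub> rho q \<mu> a \<otimes>\<^bsub>qweyl q\<^esub> w)"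

definition der_on_gens ::
    "'k::field \<Rightarrow> 'k \<Rightarrow> 'k free set \<Rightarrow> 'k free set \<Rightarrow> 'k free set \<Rightarrow> 'k free set" where
  "der_on_gens q \<mu> u v = (THE d. d \<in> Der q \<mu> \<and> d (Rx q) = u \<and> d (Ry q) = v)"

text \<open>
  The element \<open>h\<close> must be \<open>q\<close>-normal. For the relation \<open>yx = qxy + 1\<close> this is
  \<open>h = 1 - (1 - q)yx\<close>, with \<open>hx = qxh\<close> and \<open>yh = qhy\<close>; the formula \<open>1 - yx\<close> found in the literature
  belongs to the presentation \<open>yx = qxy + (1 - q)\<close>. Values \<open>u\<close>, \<open>v\<close> on \<open>x\<close>, \<open>y\<close> extend to a
  \<open>\<sigma>\<close>-derivation iff \<open>vx + \<mu>yu = q(uy + \<mu>\<^sup>-\<^sup>1xv)\<close>; for \<open>u = h\<^sup>rx\<close>, \<open>\<mu> = q\<^sup>-\<^sup>r\<close> and \<open>v\<close> a scalar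
  multiple of \<open>h\<^sup>ry\<close> this forces \<open>v = -\<mu>\<^sup>-\<^sup>1(q\<^sup>-\<^sup>1h)\<^sup>ry\<close>, with the minus sign (for \<open>r = 0\<close>,
  \<open>x \<mapsto> x\<close> and \<open>y \<mapsto> y\<close> do not extend to a derivation, whereas \<open>x \<mapsto> x\<close> and \<open>y \<mapsto> -y\<close> do).
\<close>

definition h_elt :: "'k::field \<Rightarrow> 'k free set" where
  "h_elt q = \<one>\<^bsub>qweyl q\<^esub> \<ominus>\<^bsub>qweyl q\<^esub> smul q (1 - q) (Ry q \<otimes>\<^bsub>qweyl q\<^esub> Rx q)"

definition H_der :: "'k::field \<Rightarrow> 'k \<Rightarrow> nat \<Rightarrow> 'k free set \<Rightarrow> 'k free set" where
  "H_der q \<mu> r = der_on_gens q \<mu>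
     (h_elt q [^]\<^bsub>qweyl q\<^esub> r \<otimes>\<^bsub>qweyl q\<^esub> Rx q)
     (\<ominus>\<^bsub>qweyl q\<^esub> smul q (inverse \<mu>)
        (smul q (inverse q) (h_elt q) [^]\<^bsub>qweyl q\<^esub> r \<otimes>\<^bsub>qweyl q\<^esub> Ry q))"

definition H_space :: "'k::field \<Rightarrow> 'k \<Rightarrow> ('k free set \<Rightarrow> 'k free set) set" where
  "H_space q \<mu> =
     (if \<exists>r::nat. \<mu> = q powi (- int r)
      then {(\<lambda>a\<in>carrier (qweyl q). smul q c (H_der q \<mu> r a)) | c r. \<mu> = q powi (- int r)}
      else {zero_map q})"

definition X_der :: "'k::field \<Rightarrow> 'k \<Rightarrow> nat \<Rightarrow> 'k free set \<Rightarrow> 'k free set" where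
  "X_der q \<mu> i = der_on_gens q \<mu> (Ry q [^]\<^bsub>qweyl q\<^esub> i) \<zero>\<^bsub>qweyl q\<^esub>"

definition Y_der :: "'k::field \<Rightarrow> 'k \<Rightarrow> nat \<Rightarrow> 'k free set \<Rightarrow> 'k free set" where
  "Y_der q \<mu> j = der_on_gens q \<mu> \<zero>\<^bsub>qweyl q\<^esub> (Rx q [^]\<^bsub>qweyl q\<^esub> j)"

definition P_space :: "'k::field \<Rightarrow> 'k \<Rightarrow> ('k free set \<Rightarrow> 'k free set) set" where
  "P_space q \<mu> =
     (if \<mu> = q
      then {(\<lambda>a\<in>carrier (qweyl q).
               (\<Oplus>\<^bsub>qweyl q\<^esub> i\<in>{..<m}. smul q (s i) (X_der q \<mu> i a)) \<oplus>\<^bsub>qweyl q\<^esub>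
               (\<Oplus>\<^bsub>qweyl q\<^esub> j\<in>{..<n}. smul q (t j) (Y_der q \<mu> j a)))
            | (m::nat) (n::nat) (s::nat \<Rightarrow> 'k) (t::nat \<Rightarrow> 'k). True}
      else {zero_map q})"


section \<open>Isotropy groups\<close>

definition isotropy ::
    "'k::field \<Rightarrow> ('k free set \<Rightarrow> 'k free set) \<Rightarrow> ('k free set \<Rightarrow> 'k free set) set" where
  "isotropy q d = {f \<in> Aut q. compose (carrier (qweyl q)) f d = compose (carrier (qweyl q)) d f}"

abbreviation Aut_subgroup ::
    "'k::field \<Rightarrow> ('k free set \<Rightarrow> 'k free set) set \<Rightarrow> ('k free set \<Rightarrow> 'k free set) monoid" where
  "Aut_subgroup q A \<equiv> (BijGroup (carrier (qweyl q))) \<lparr>carrier := A\<rparr>"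

abbreviation kstar :: "('k::field) monoid" where
  "kstar \<equiv> units_of ring_of_type_algebra"

definition exps :: "'k::field poly \<Rightarrow> nat set" where
  "exps p = {e. Polynomial.coeff p e \<noteq> 0}"

definition gcd_S :: "(nat \<times> nat \<Rightarrow>\<^sub>0 'k::field) \<Rightarrow> nat" where
  "gcd_S c = nat (Gcd {int j - int i | i j. Poly_Mapping.lookup c (i, j) \<noteq> 0})"

end

theory Submission
  imports Defs
begin

text \<open>
  The monomials \<open>x\<^sup>i y\<^sup>j\<close> form a basis of \<open>R\<close>, with leading coefficients for the
  lexicographic order (exponent of \<open>y\<close> first) multiplicative up to powers of \<open>q\<close>; hence \<open>R\<close> has no
  zero divisors and its units are scalars. The normal element \<open>h = q(yx - xy)\<close> generates the commutator ideal, so an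
  automorphism maps \<open>h\<close> to a scalar multiple of itself. Conjugation by \<open>h\<close> scales \<open>x\<^sup>i y\<^sup>j\<close> by
  \<open>q\<^sup>i\<^sup>-\<^sup>j\<close>, so the images of \<open>x\<close> and \<open>y\<close> are homogeneous of weights
  \<open>-1\<close> and \<open>1\<close> for the grading by \<open>j - i\<close>, and comparing leading monomials in the relation
  leaves only the automorphisms \<open>\<rho>\<^sub>\<beta>\<close>.

  An automorphism \<open>\<rho>\<^sub>\<beta>\<close> commutes with a \<open>\<sigma>\<close>-derivation \<open>d\<close> iff it scales \<open>d(x)\<close> and
  \<open>d(y)\<close> like \<open>x\<close> and \<open>y\<close>. This is automatic for multiples of \<open>h\<^sup>r x\<close>, \<open>h\<^sup>r y\<close>, it reads
  \<open>\<beta>\<^sup>e\<^sup>+\<^sup>1 = 1\<close> for the monomials of elements of \<open>\<P>\<^sub>\<mu>\<close>, and for \<open>I\<^sub>w\<close> it says that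
  \<open>I\<^sub>v = 0\<close> for \<open>v = \<rho>\<^sub>\<beta>(w) - w\<close>; since \<open>v\<close> has no component of weight \<open>0\<close> while
  \<open>I\<^sub>v = 0\<close> forces weight \<open>0\<close>, this means \<open>v = 0\<close>. For \<open>\<delta> = I\<^sub>w + \<eta> + \<xi>\<close> with
  \<open>\<mu> = q\<close>, an automorphism commuting with \<open>\<delta>\<close> puts \<open>I\<^sub>v(x)\<close> into \<open>\<bbbk>[y]\<close>, which again forces \<open>v = 0\<close>.
\<close>

section \<open>Linear maps on the free algebra\<close>

lemma poly_mapping_sum_singles:
  "f = (\<Sum>w\<in>Poly_Mapping.keys f. Poly_Mapping.single w (Poly_Mapping.lookup f w))"
  for f :: "'a \<Rightarrow>\<^sub>0 'b::comm_monoid_add"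
proof (rule poly_mapping_eqI)
  fix k
  have "Poly_Mapping.lookup (\<Sum>w\<in>Poly_Mapping.keys f. Poly_Mapping.single w (Poly_Mapping.lookup f w)) k
      = (\<Sum>w\<in>Poly_Mapping.keys f. if w = k then Poly_Mapping.lookup f k else 0)"
    by (auto simp: lookup_sum lookup_single when_def intro!: sum.cong)
  also have "\<dots> = Poly_Mapping.lookup f k"
    by (simp add: in_keys_iff)
  finally show "Poly_Mapping.lookup f k
      = Poly_Mapping.lookup (\<Sum>w\<in>Poly_Mapping.keys f. Poly_Mapping.single w (Poly_Mapping.lookup f w)) k" ..
qed

text \<open>Zero is covered by the first case, as a \<open>single\<close> with coefficient
  0.\<close>

lemma poly_mapping_single_induct [case_names single add]:
  fixes f :: "'a \<Rightarrow>\<^sub>0 'b::comm_monoid_add"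
  assumes "\<And>w c. P (Poly_Mapping.single w c)" and "\<And>f g. P f \<Longrightarrow> P g \<Longrightarrow> P (f + g)"
  shows "P f"
proof -
  have 0: "P 0" using assms(1)[of undefined 0] by simp
  have "P (\<Sum>w\<in>A. Poly_Mapping.single w (Poly_Mapping.lookup f w))" if "finite A" for A
    using that by induction (auto intro: assms 0)
  from this[of "Poly_Mapping.keys f"] show ?thesis
    using poly_mapping_sum_singles[of f] by simp
qed

lemma single_Word_Cons:
  fixes c :: "'k::field"
  shows "Poly_Mapping.single (Word (GX # u)) c = free_x * Poly_Mapping.single (Word u) c"
    and "Poly_Mapping.single (Word (GY # u)) c = free_y * Poly_Mapping.single (Word u) c"
  by (simp_all add: mult_single)

lemma single_Word_Nil: "Poly_Mapping.single (Word []) c = free_const c"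
  by (simp add: zero_word_def)

lemma free_const_mult: "free_const (c * d) = free_const c * (free_const d :: 'k::field free)"
  by (simp add: mult_single)

lemma free_const_commute: "f * free_const c = free_const c * (f :: 'k::field free)"
  by (induction f rule: poly_mapping_single_induct)
     (simp_all add: mult_single algebra_simps)

lemma free_const_left_commute:
  "f * (free_const c * g) = free_const c * (f * (g :: 'k::field free))"
  by (metis free_const_commute mult.assoc)

text \<open>Words are peeled from the left, which matches the recursions of \<open>der_word\<close>
  and \<open>nf_word\<close>.\<close>

lemma free_induct [case_names const x y add]:
  fixes f :: "'k::field free"
  assumes const: "\<And>c. P (free_const c)"
    and x: "\<And>f. P f \<Longrightarrow> P (free_x * f)"
    and y: "\<And>f. P f \<Longrightarrow> P (free_y * f)"
    and add: "\<And>f g. P f \<Longrightarrow> P g \<Longrightarrow> P (f + g)"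
  shows "P f"
proof (induction f rule: poly_mapping_single_induct)
  case (single w c)
  obtain u where "w = Word u" by (cases w)
  moreover have "P (Poly_Mapping.single (Word u) c)"
  proof (induction u)
    case Nil
    show ?case by (simp only: single_Word_Nil const)
  next
    case (Cons g u)
    then show ?case by (cases g) (simp_all only: single_Word_Cons[of u] x y)
  qed
  ultimately show ?case by simp
qed (rule add)

text \<open>Common source of the algebra homomorphisms and of the skew derivations of the free
  algebra: both are fixed by their values on words.\<close>

definition lin_ext :: "(word \<Rightarrow> 'k::field free) \<Rightarrow> 'k free \<Rightarrow> 'k free" where
  "lin_ext F f = (\<Sum>w\<in>Poly_Mapping.keys f. free_const (Poly_Mapping.lookup f w) * F w)"

lemma lin_ext_add: "lin_ext F (f + g) = lin_ext F f + lin_ext F g"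
  unfolding lin_ext_def
  by (rule setsum_keys_plus_distrib) (simp_all add: single_add algebra_simps)

lemma lin_ext_single: "lin_ext F (Poly_Mapping.single w c) = free_const c * F w"
  by (simp add: lin_ext_def)

lemma lin_ext_const: "lin_ext F (free_const c * f) = free_const c * lin_ext F f"
  by (induction f rule: poly_mapping_single_induct)
     (simp_all add: lin_ext_single lin_ext_add distrib_left mult_single flip: mult.assoc)

section \<open>Homomorphisms of the free algebra\<close>

fun hom_word :: "(gen \<Rightarrow> 'k::field free) \<Rightarrow> word \<Rightarrow> 'k free" where
  "hom_word F (Word u) = prod_list (map F u)"

definition free_hom :: "(gen \<Rightarrow> 'k::field free) \<Rightarrow> 'k free \<Rightarrow> 'k free" where
  "free_hom F = lin_ext (hom_word F)"

lemma free_hom_add: "free_hom F (f + g) = free_hom F f + free_hom F g"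
  by (simp add: free_hom_def lin_ext_add)

lemma free_hom_single: "free_hom F (Poly_Mapping.single (Word u) c) = free_const c * prod_list (map F u)"
  by (simp add: free_hom_def lin_ext_single)

lemma free_hom_const [simp]: "free_hom F (free_const c) = free_const c"
  by (simp add: free_hom_single flip: single_Word_Nil)

lemma free_hom_x [simp]: "free_hom F free_x = F GX"
  and free_hom_y [simp]: "free_hom F free_y = F GY"
  by (simp_all add: free_hom_single)

lemma free_hom_mult: "free_hom F (f * g) = free_hom F f * free_hom F g"
proof (induction f rule: poly_mapping_single_induct)
  case (single w c)
  obtain u where w: "w = Word u" by (cases w)
  show ?case unfolding w
  proof (induction g rule: poly_mapping_single_induct)
    case (single v d)
    obtain t where v: "v = Word t" by (cases v)
    show ?case
      by (simp add: v mult_single free_hom_single, simp add: free_const_mult mult.assoc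
          free_const_left_commute[of "prod_list (map F u)"])
  qed (simp add: free_hom_add algebra_simps)
qed (simp add: free_hom_add algebra_simps)

lemma free_hom_1 [simp]: "free_hom F 1 = 1"
  using free_hom_const[of F 1] by simp

text \<open>Lift of \<open>rho q \<beta>\<close> to the free algebra. It descends to R because yx,
  xy and 1 all have weight 0 when x has weight -1 and y has weight 1.\<close>

definition diag_hom :: "'k::field \<Rightarrow> 'k free \<Rightarrow> 'k free" where
  "diag_hom \<beta> = free_hom (case_gen (free_const (inverse \<beta>) * free_x) (free_const \<beta> * free_y))"

lemma diag_hom_simps [simp]:
  "diag_hom \<beta> (f + g) = diag_hom \<beta> f + diag_hom \<beta> g"
  "diag_hom \<beta> (f * g) = diag_hom \<beta> f * diag_hom \<beta> g"
  "diag_hom \<beta> (free_const c) = free_const c"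
  "diag_hom \<beta> 1 = 1"
  "diag_hom \<beta> free_x = free_const (inverse \<beta>) * free_x"
  "diag_hom \<beta> free_y = free_const \<beta> * free_y"
  by (simp_all add: diag_hom_def free_hom_add free_hom_mult)

lemma diag_hom_0 [simp]: "diag_hom \<beta> 0 = 0"
  using diag_hom_simps(3)[of \<beta> 0] by simp

lemma diag_hom_minus [simp]: "diag_hom \<beta> (- f) = - diag_hom \<beta> f"
  using diag_hom_simps(1)[of \<beta> f "-f"] by (simp add: add_eq_0_iff del: diag_hom_simps)

lemma diag_hom_diff [simp]: "diag_hom \<beta> (f - g) = diag_hom \<beta> f - diag_hom \<beta> g"
  using diag_hom_simps(1)[of \<beta> f "-g"] by simp

section \<open>Skew derivations of the free algebra\<close>

fun der_word :: "'k::field \<Rightarrow> 'k free \<Rightarrow> 'k free \<Rightarrow> gen list \<Rightarrow> 'k free" where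
  "der_word \<mu> u v [] = 0"
| "der_word \<mu> u v (GX # w) = u * Poly_Mapping.single (Word w) 1 + diag_hom \<mu> free_x * der_word \<mu> u v w"
| "der_word \<mu> u v (GY # w) = v * Poly_Mapping.single (Word w) 1 + diag_hom \<mu> free_y * der_word \<mu> u v w"

text \<open>The skew derivation of the free algebra with twist \<open>diag_hom \<mu>\<close> and
  arbitrary values \<open>u\<close>, \<open>v\<close> at the generators; \<open>der_word\<close> is
  its Leibniz rule unrolled from the left. The relation of R enters only when it is pushed down to
  the quotient.\<close>

definition free_der :: "'k::field \<Rightarrow> 'k free \<Rightarrow> 'k free \<Rightarrow> 'k free \<Rightarrow> 'k free" where
  "free_der \<mu> u v = lin_ext (\<lambda>w. case w of Word t \<Rightarrow> der_word \<mu> u v t)"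

lemma free_der_add: "free_der \<mu> u v (f + g) = free_der \<mu> u v f + free_der \<mu> u v g"
  by (simp add: free_der_def lin_ext_add)

lemma free_der_scale: "free_der \<mu> u v (free_const c * f) = free_const c * free_der \<mu> u v f"
  by (simp add: free_der_def lin_ext_const)

lemma free_der_const [simp]: "free_der \<mu> u v (free_const c) = 0"
  by (simp add: free_der_def lin_ext_single flip: single_Word_Nil)

lemma free_der_x_mult:
  "free_der \<mu> u v (free_x * f) = u * f + diag_hom \<mu> free_x * free_der \<mu> u v f"
proof (induction f rule: poly_mapping_single_induct)
  case (single w c)
  obtain t where w: "w = Word t" by (cases w)
  have 1: "Poly_Mapping.single (Word t) c = free_const c * Poly_Mapping.single (Word t) 1"
    by (simp add: mult_single)
  show ?case
    unfolding w single_Word_Cons(1)[symmetric] unfolding free_der_def lin_ext_single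
    by (simp add: distrib_left mult.assoc 1 free_const_left_commute[of u]
        free_const_left_commute[of free_x] free_const_left_commute[of "free_const (inverse \<mu>)"]
        free_const_left_commute[of "free_const \<mu>" "c"])
qed (simp add: free_der_add algebra_simps)

lemma free_der_y_mult:
  "free_der \<mu> u v (free_y * f) = v * f + diag_hom \<mu> free_y * free_der \<mu> u v f"
proof (induction f rule: poly_mapping_single_induct)
  case (single w c)
  obtain t where w: "w = Word t" by (cases w)
  have 1: "Poly_Mapping.single (Word t) c = free_const c * Poly_Mapping.single (Word t) 1"
    by (simp add: mult_single)
  show ?case
    unfolding w single_Word_Cons(2)[symmetric] unfolding free_der_def lin_ext_single
    by (simp add: distrib_left mult.assoc 1 free_const_left_commute[of v]
        free_const_left_commute[of free_y] free_const_left_commute[of "free_const (inverse \<mu>)"]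
        free_const_left_commute[of "free_const \<mu>" "c"])
qed (simp add: free_der_add algebra_simps)

text \<open>Induction on the left factor works because the Leibniz rule for a generator on the left
  is built into \<open>der_word\<close>.\<close>

lemma free_der_mult:
  "free_der \<mu> u v (f * g) = free_der \<mu> u v f * g + diag_hom \<mu> f * free_der \<mu> u v g"
proof (induction f rule: free_induct)
  case (const c)
  show ?case by (simp add: free_der_scale)
next
  case (x f)
  show ?case by (simp add: mult.assoc free_der_x_mult x) (simp add: algebra_simps)
next
  case (y f)
  show ?case by (simp add: mult.assoc free_der_y_mult y) (simp add: algebra_simps)
next
  case (add f g)
  then show ?case by (simp add: free_der_add algebra_simps)
qed

lemma free_der_x [simp]: "free_der \<mu> u v free_x = u"
  using free_der_x_mult[of \<mu> u v 1] free_der_const[of \<mu> u v 1] by simp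

lemma free_der_y [simp]: "free_der \<mu> u v free_y = v"
  using free_der_y_mult[of \<mu> u v 1] free_der_const[of \<mu> u v 1] by simp

section \<open>The defining ideal\<close>

definition qweyl_rel :: "'k::field \<Rightarrow> 'k free" where
  "qweyl_rel q = free_y * free_x - (free_const q * free_x * free_y + 1)"

lemma free_ring_simps:
  "carrier free_ring = UNIV" "monoid.mult free_ring = (*)" "monoid.one free_ring = 1"
  "ring.zero free_ring = 0" "ring.add free_ring = (+)"
  by (simp_all add: ring_of_type_algebra_def)

lemma ring_of_type_algebra_ring: "ring (ring_of_type_algebra :: 'a::ring_1 ring)"
proof -
  have "\<exists>y. x + y = 0" for x :: 'a
    using add.right_inverse by blast
  then show ?thesis
    unfolding ring_of_type_algebra_def using add.right_inverse
    by unfold_locales (auto simp: algebra_simps Units_def)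
qed

interpretation free: ring "free_ring :: 'k::field free ring"
  by (rule ring_of_type_algebra_ring)

lemma free_a_inv: "a_inv free_ring f = - (f :: 'k::field free)"
  by (rule free.minus_equality) (simp_all add: free_ring_simps)

lemma free_idealI:
  assumes "\<And>a b. a \<in> J \<Longrightarrow> b \<in> J \<Longrightarrow> a + b \<in> J" "0 \<in> J"
    "\<And>a r. a \<in> J \<Longrightarrow> r * a \<in> J" "\<And>a r. a \<in> J \<Longrightarrow> a * r \<in> J"
  shows "ideal J (free_ring :: 'k::field free ring)"
proof (rule idealI)
  show "ring (free_ring :: 'k free ring)" by (rule ring_of_type_algebra_ring)
  show "subgroup J (add_monoid (free_ring :: 'k free ring))"
  proof (rule subgroup.intro)
    fix x assume "x \<in> J"
    then have "- x \<in> J" using assms(3)[of x "-1"] by simp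
    moreover have "inv\<^bsub>add_monoid (free_ring :: 'k free ring)\<^esub> x = - x"
      using free_a_inv[of x] by (simp add: a_inv_def)
    ultimately show "inv\<^bsub>add_monoid (free_ring :: 'k free ring)\<^esub> x \<in> J" by simp
  qed (auto simp: free_ring_simps assms)
qed (auto simp: free_ring_simps assms)

lemma ideal_qweyl_ideal: "ideal (qweyl_ideal q) free_ring"
  unfolding qweyl_ideal_def
  by (rule free.genideal_ideal) (simp add: free_ring_simps)

lemma qI_closed:
  "0 \<in> qweyl_ideal q"
  "a \<in> qweyl_ideal q \<Longrightarrow> b \<in> qweyl_ideal q \<Longrightarrow> a + b \<in> qweyl_ideal q"
  "a \<in> qweyl_ideal q \<Longrightarrow> r * a \<in> qweyl_ideal q"
  "a \<in> qweyl_ideal q \<Longrightarrow> a * r \<in> qweyl_ideal q"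
  "a \<in> qweyl_ideal q \<Longrightarrow> - a \<in> qweyl_ideal q"
  "a \<in> qweyl_ideal q \<Longrightarrow> b \<in> qweyl_ideal q \<Longrightarrow> a - b \<in> qweyl_ideal q"
proof -
  interpret qI: ideal "qweyl_ideal q" free_ring by (rule ideal_qweyl_ideal)
  show z: "0 \<in> qweyl_ideal q" using qI.zero_closed by (simp add: free_ring_simps)
  show p: "a \<in> qweyl_ideal q \<Longrightarrow> b \<in> qweyl_ideal q \<Longrightarrow> a + b \<in> qweyl_ideal q" for a b
    using qI.a_closed[of a b] by (simp add: free_ring_simps)
  show l: "a \<in> qweyl_ideal q \<Longrightarrow> r * a \<in> qweyl_ideal q" for a r
    using qI.I_l_closed[of a r] by (simp add: free_ring_simps)
  show "a \<in> qweyl_ideal q \<Longrightarrow> a * r \<in> qweyl_ideal q"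
    using qI.I_r_closed[of a r] by (simp add: free_ring_simps)
  show m: "a \<in> qweyl_ideal q \<Longrightarrow> - a \<in> qweyl_ideal q" for a
    using l[of a "-1"] by simp
  show "a \<in> qweyl_ideal q \<Longrightarrow> b \<in> qweyl_ideal q \<Longrightarrow> a - b \<in> qweyl_ideal q"
    using p[OF _ m, of a b] by simp
qed

lemma qweyl_rel_in: "qweyl_rel q \<in> qweyl_ideal q"
  using free.genideal_self[of "{qweyl_rel q}"]
  by (simp add: qweyl_ideal_def free_ring_simps qweyl_rel_def)

lemma qweyl_ideal_minimal:
  assumes "ideal J (free_ring :: 'k::field free ring)" "qweyl_rel q \<in> J"
  shows "qweyl_ideal q \<subseteq> J"
  using free.genideal_minimal[OF assms(1), of "{qweyl_rel q}"] assms(2)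
  by (simp add: qweyl_ideal_def qweyl_rel_def)

section \<open>Normal forms\<close>

text \<open>The q-integer [n], which appears in the commutation rule y x^n = q^n x^n y + [n]
  x^(n-1).\<close>

definition qnum :: "'k::field \<Rightarrow> nat \<Rightarrow> 'k" where
  "qnum q n = (\<Sum>k<n. q ^ k)"

lemma qnum_0 [simp]: "qnum q 0 = 0"
  and qnum_Suc: "qnum q (Suc n) = qnum q n + q ^ n"
  by (simp_all add: qnum_def)

lemma qnum_Suc': "qnum q (Suc n) = 1 + q * qnum q n"
proof (induction n)
  case (Suc n)
  have "qnum q (Suc (Suc n)) = (1 + q * qnum q n) + q ^ Suc n"
    by (simp only: qnum_Suc[of q "Suc n"] Suc)
  also have "\<dots> = 1 + q * (qnum q n + q ^ n)" by (simp add: algebra_simps)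
  finally show ?case by (simp only: qnum_Suc)
qed (simp add: qnum_Suc)

text \<open>From (q - 1)[n] = q^n - 1, whose right side is nonzero for positive n.\<close>

lemma qnum_eq_0_iff:
  assumes "\<And>n::nat. n > 0 \<Longrightarrow> q ^ n \<noteq> 1"
  shows "qnum q n = 0 \<longleftrightarrow> n = 0"
proof -
  have "(q - 1) * qnum q n = q ^ n - 1"
    unfolding qnum_def by (simp add: power_diff_1_eq)
  then show ?thesis using assms[of n] by (cases "n = 0") auto
qed

type_synonym 'k coeffs = "nat \<times> nat \<Rightarrow> 'k"

section \<open>Multiplication by generators on coefficient families\<close>

definition left_x :: "'k::field coeffs \<Rightarrow> 'k coeffs" where
  "left_x a = (\<lambda>(i, j). if i = 0 then 0 else a (i - 1, j))"

text \<open>Coefficient form of y x^i = q^i x^i y + [i] x^(i-1): the monomial x^i y^j receives a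
  contribution from x^i y^(j-1) and one from x^(i+1) y^j.\<close>

definition left_y :: "'k::field \<Rightarrow> 'k coeffs \<Rightarrow> 'k coeffs" where
  "left_y q a = (\<lambda>(i, j). q ^ i * (if j = 0 then 0 else a (i, j - 1)) + qnum q (Suc i) * a (Suc i, j))"

text \<open>Mirror image of \<open>left_y\<close>, from y^j x = q^j x y^j + [j] y^(j-1).\<close>

definition right_x :: "'k::field \<Rightarrow> 'k coeffs \<Rightarrow> 'k coeffs" where
  "right_x q a = (\<lambda>(i, j). q ^ j * (if i = 0 then 0 else a (i - 1, j)) + qnum q (Suc j) * a (i, Suc j))"

definition right_y :: "'k::field coeffs \<Rightarrow> 'k coeffs" where
  "right_y a = (\<lambda>(i, j). if j = 0 then 0 else a (i, j - 1))"

fun nf_word :: "'k::field \<Rightarrow> gen list \<Rightarrow> 'k coeffs" where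
  "nf_word q [] = (\<lambda>p. if p = (0, 0) then 1 else 0)"
| "nf_word q (GX # u) = left_x (nf_word q u)"
| "nf_word q (GY # u) = left_y q (nf_word q u)"

text \<open>The left action of the free algebra on the span of the monomials \<open>x\<^sup>i y\<^sup>j\<close>, applied to \<open>1\<close>.\<close>

definition nf :: "'k::field \<Rightarrow> 'k free \<Rightarrow> 'k coeffs" where
  "nf q f = (\<lambda>p. \<Sum>w\<in>Poly_Mapping.keys f. Poly_Mapping.lookup f w * nf_word q (case w of Word u \<Rightarrow> u) p)"

lemma nf_add: "nf q (f + g) p = nf q f p + nf q g p"
  unfolding nf_def by (rule setsum_keys_plus_distrib) (simp_all add: algebra_simps)

lemma nf_single: "nf q (Poly_Mapping.single (Word u) c) p = c * nf_word q u p"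
  by (simp add: nf_def)

lemma nf_scale: "nf q (free_const c * f) p = c * nf q f p"
proof (induction f rule: poly_mapping_single_induct)
  case (single w d)
  then show ?case by (cases w) (simp add: mult_single nf_single)
qed (simp add: nf_add algebra_simps)

lemma nf_const: "nf q (free_const c) p = (if p = (0, 0) then c else 0)"
  by (simp add: nf_single flip: single_Word_Nil)

lemma nf_0 [simp]: "nf q 0 p = 0"
  by (simp add: nf_def)

lemma nf_1: "nf q 1 p = (if p = (0, 0) then 1 else 0)"
  using nf_const[of q 1] by simp

lemma nf_minus: "nf q (- f) p = - nf q f p"
  using nf_add[of q f "- f" p] by (simp add: add_eq_0_iff)

lemma nf_diff: "nf q (f - g) p = nf q f p - nf q g p"
  using nf_add[of q f "- g" p] by (simp add: nf_minus)

lemma nf_sum: "nf q (\<Sum>s\<in>A. F s) p = (\<Sum>s\<in>A. nf q (F s) p)"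
  by (induction A rule: infinite_finite_induct) (simp_all add: nf_add)

lemma nf_eqI: "(\<And>i j. nf q f (i, j) = nf q g (i, j)) \<Longrightarrow> nf q f = nf q g"
  by auto

lemma nf_left_x: "nf q (free_x * f) = left_x (nf q f)"
proof (rule ext)
  fix p show "nf q (free_x * f) p = left_x (nf q f) p"
  proof (induction f rule: poly_mapping_single_induct)
    case (single w c)
    obtain u where w: "w = Word u" by (cases w)
    show ?case unfolding w single_Word_Cons(1)[symmetric]
      by (cases p) (simp add: nf_single left_x_def)
  qed (auto simp: nf_add algebra_simps left_x_def split: prod.splits)
qed

lemma nf_left_y: "nf q (free_y * f) = left_y q (nf q f)"
proof (rule ext)
  fix p show "nf q (free_y * f) p = left_y q (nf q f) p"
  proof (induction f rule: poly_mapping_single_induct)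
    case (single w c)
    obtain u where w: "w = Word u" by (cases w)
    show ?case unfolding w single_Word_Cons(2)[symmetric]
      by (cases p) (simp add: nf_single left_y_def algebra_simps)
  qed (auto simp: nf_add algebra_simps left_y_def split: prod.splits)
qed

text \<open>The operator \<open>right_x\<close> commutes with \<open>left_x\<close> and
  \<open>left_y\<close> and has the right effect on scalars, so the left recursion that defines
  \<open>nf\<close> carries it through.\<close>

lemma nf_right_x: "nf q (f * free_x) = right_x q (nf q f)"
proof (rule ext)
  fix p show "nf q (f * free_x) p = right_x q (nf q f) p"
  proof (induction f arbitrary: p rule: free_induct)
    case (const c)
    show ?case
      using nf_left_x[of q 1]
      by (cases p) (auto simp: nf_scale nf_const nf_1 left_x_def right_x_def)
  next
    case (x f)
    show ?case
      by (cases p) (auto simp: mult.assoc nf_left_x left_x_def right_x_def x)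
  next
    case (y f)
    obtain i j where p: "p = (i, j)" by (cases p)
    show ?case
      unfolding p
      by (cases i; cases j)
         (simp_all add: mult.assoc nf_left_y left_y_def right_x_def y qnum_Suc algebra_simps)
  next
    case (add f g)
    then show ?case by (cases p) (simp add: nf_add algebra_simps right_x_def)
  qed
qed

lemma nf_right_y: "nf q (f * free_y) = right_y (nf q f)"
proof (rule ext)
  fix p show "nf q (f * free_y) p = right_y (nf q f) p"
  proof (induction f arbitrary: p rule: free_induct)
    case (const c)
    show ?case
      using nf_left_y[of q 1]
      by (cases p) (auto simp: nf_scale nf_const nf_1 left_y_def right_y_def)
  next
    case (x f)
    show ?case
      by (cases p) (auto simp: mult.assoc nf_left_x left_x_def right_y_def x)
  next
    case (y f)
    obtain i j where p: "p = (i, j)" by (cases p)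
    show ?case
      unfolding p
      by (cases i; cases j)
         (simp_all add: mult.assoc nf_left_y left_y_def right_y_def y qnum_Suc algebra_simps)
  next
    case (add f g)
    then show ?case by (cases p) (simp add: nf_add algebra_simps right_y_def)
  qed
qed

text \<open>The operators \<open>left_x\<close> and \<open>left_y\<close> satisfy the defining
  relation, so the coefficient families form a module over R.\<close>

lemma nf_rel_mult: "nf q (qweyl_rel q * g) p = 0"
proof -
  have e: "qweyl_rel q * g = free_y * (free_x * g) - free_const q * (free_x * (free_y * g)) - g"
    by (simp add: qweyl_rel_def algebra_simps)
  obtain i j where "p = (i, j)" by (cases p)
  then show ?thesis unfolding e
    by (cases i; cases j)
       (simp_all add: nf_diff nf_add nf_scale nf_left_x nf_left_y left_x_def left_y_def qnum_Suc' algebra_simps)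
qed

text \<open>A product acts on 1 by letting its left factor act on the result of the right
  factor.\<close>

lemma nf_mult_left_cong:
  assumes "nf q f = nf q g"
  shows "nf q (r * f) = nf q (r * g)"
proof (rule ext)
  fix p show "nf q (r * f) p = nf q (r * g) p"
    by (induction r arbitrary: p rule: free_induct)
       (use assms in \<open>auto simp: nf_scale mult.assoc nf_left_x nf_left_y nf_add distrib_right
          left_x_def left_y_def split: prod.splits\<close>)
qed

text \<open>The elements acting as zero form a two-sided ideal that contains the relation.\<close>

lemma nf_ideal:
  assumes "f \<in> qweyl_ideal q"
  shows "nf q f p = 0"
proof -
  \<comment> \<open>Quantifying over right factors \<open>g\<close> gives closure under right
    multiplication at once; \<open>g = 1\<close> recovers the claim.\<close>
  let ?J = "{f. \<forall>g p. nf q (f * g) p = 0}"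
  have l: "r * a \<in> ?J" if "a \<in> ?J" for a r
  proof -
    have "nf q (r * (a * g)) = nf q (r * 0)" for g
      using that by (intro nf_mult_left_cong) auto
    then show ?thesis by (simp add: mult.assoc)
  qed
  have "ideal ?J free_ring"
    by (rule free_idealI) (use l in \<open>auto simp: nf_add distrib_right mult.assoc\<close>)
  moreover have "qweyl_rel q \<in> ?J" by (simp add: nf_rel_mult)
  ultimately have "f \<in> ?J" using qweyl_ideal_minimal assms by blast
  then have "nf q (f * 1) p = 0" by blast
  then show ?thesis by simp
qed

section \<open>The basis of ordered monomials\<close>

definition qmonom :: "nat \<times> nat \<Rightarrow> 'k::field free" where
  "qmonom p = free_x ^ fst p * free_y ^ snd p"

definition from_coeffs :: "(nat \<times> nat \<Rightarrow>\<^sub>0 'k::field) \<Rightarrow> 'k free" where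
  "from_coeffs c = (\<Sum>p\<in>Poly_Mapping.keys c. free_const (Poly_Mapping.lookup c p) * qmonom p)"

lemma nf_monom: "nf q (qmonom p) = (\<lambda>s. if s = p then 1 else 0)"
proof -
  have y: "nf q (free_y ^ j) (i, l) = (if (i, l) = (0, j) then 1 else 0)" for i j l
    by (induction j arbitrary: i l) (auto simp: nf_1 power_Suc2 nf_right_y right_y_def simp del: power_Suc)
  have "nf q (free_x ^ m * free_y ^ j) (i, l) = (if (i, l) = (m, j) then 1 else 0)" for m i j l
    by (induction m arbitrary: i l) (auto simp: y mult.assoc nf_left_x left_x_def)
  then show ?thesis by (auto simp: qmonom_def fun_eq_iff)
qed

lemma nf_from_coeffs: "nf q (from_coeffs c) p = Poly_Mapping.lookup c p"
proof -
  have "nf q (from_coeffs c) p = (\<Sum>s\<in>Poly_Mapping.keys c. if p = s then Poly_Mapping.lookup c s else 0)"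
    by (simp add: from_coeffs_def nf_sum nf_scale nf_monom if_distrib[of "\<lambda>x. _ * x"] cong: if_cong)
  then show ?thesis by (simp add: in_keys_iff)
qed

lemma from_coeffs_add: "from_coeffs (c + d) = from_coeffs c + from_coeffs d"
  unfolding from_coeffs_def
  by (rule setsum_keys_plus_distrib) (simp_all add: single_add distrib_right)

lemma from_coeffs_single: "from_coeffs (Poly_Mapping.single p c) = free_const c * qmonom p"
  by (simp add: from_coeffs_def)

text \<open>Spanning: the elements congruent to a combination of ordered monomials contain the
  scalars and are closed under sums and under left multiplication by x and y.\<close>

lemma ex_from_coeffs:
  fixes f :: "'k::field free"
  shows "\<exists>c. f - from_coeffs c \<in> qweyl_ideal q"
proof -
  define S where "S = {f. \<exists>c. f - from_coeffs c \<in> qweyl_ideal q}"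
  have S_add: "f + g \<in> S" if fg: "f \<in> S" "g \<in> S" for f g
  proof -
    obtain c d where "f - from_coeffs c \<in> qweyl_ideal q" "g - from_coeffs d \<in> qweyl_ideal q"
      using fg by (auto simp: S_def)
    then have "(f - from_coeffs c) + (g - from_coeffs d) \<in> qweyl_ideal q" by (rule qI_closed)
    then have "f + g - from_coeffs (c + d) \<in> qweyl_ideal q"
      by (simp add: from_coeffs_add algebra_simps)
    then show ?thesis by (auto simp: S_def)
  qed
  have S_cong: "f \<in> S" if g: "g \<in> S" and fg: "f - g \<in> qweyl_ideal q" for f g
  proof -
    obtain c where "g - from_coeffs c \<in> qweyl_ideal q" using g by (auto simp: S_def)
    from qI_closed(2)[OF fg this] show ?thesis by (auto simp: S_def)
  qed
  have S_monom: "free_const c * qmonom p \<in> S" for c p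
    using qI_closed(1)[of q] by (auto simp: S_def simp flip: from_coeffs_single intro!: exI[of _ "Poly_Mapping.single p c"])
  have S_coeffs: "G * f \<in> S" if f: "f \<in> S" and G: "\<And>c p. free_const c * (G * qmonom p) \<in> S" for G f
  proof -
    obtain c where c: "f - from_coeffs c \<in> qweyl_ideal q" using f by (auto simp: S_def)
    have "G * from_coeffs c \<in> S"
    proof (induction c rule: poly_mapping_single_induct)
      case (single w c)
      show ?case by (simp add: from_coeffs_single free_const_left_commute[of G] G)
    qed (simp add: from_coeffs_add distrib_left S_add)
    moreover have "G * f - G * from_coeffs c \<in> qweyl_ideal q"
      using qI_closed(3)[OF c, of G] by (simp add: algebra_simps)
    ultimately show ?thesis by (rule S_cong)
  qed
  have x: "free_x * f \<in> S" if "f \<in> S" for f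
  proof (rule S_coeffs[OF that])
    fix c p
    have "free_x * qmonom p = (qmonom (Suc (fst p), snd p) :: 'k free)"
      by (simp add: qmonom_def mult.assoc)
    then show "free_const c * (free_x * qmonom p) \<in> S" using S_monom[of c "(Suc (fst p), snd p)"] by (simp only:)
  qed
  have scale: "free_const c * f \<in> S" if "f \<in> S" for c f
    using that by (rule S_coeffs) (simp add: S_monom flip: mult.assoc free_const_mult)
  \<comment> \<open>Induction on the exponent of x: the relation moves y past one x at a time, and
    the error is the relation times a monomial.\<close>
  have ym: "free_y * qmonom (i, j) \<in> S" for i j
  proof (induction i)
    case 0
    show ?case using S_monom[of 1 "(0, Suc j)"] by (simp add: qmonom_def)
  next
    case (Suc i)
    have "free_const q * (free_x * (free_y * qmonom (i, j))) + free_const 1 * qmonom (i, j) \<in> S"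
      by (intro S_add scale x Suc S_monom)
    moreover have "free_y * qmonom (Suc i, j)
        - (free_const q * (free_x * (free_y * qmonom (i, j))) + free_const 1 * qmonom (i, j))
        = qweyl_rel q * qmonom (i, j)"
      by (simp add: qmonom_def qweyl_rel_def algebra_simps)
    then have "free_y * qmonom (Suc i, j)
        - (free_const q * (free_x * (free_y * qmonom (i, j))) + free_const 1 * qmonom (i, j))
        \<in> qweyl_ideal q" by (simp only: qI_closed(4) qweyl_rel_in)
    ultimately show ?case by (rule S_cong)
  qed
  have y: "free_y * f \<in> S" if "f \<in> S" for f
    using that by (rule S_coeffs) (auto intro: scale ym)
  have "f \<in> S"
  proof (induction f rule: free_induct)
    case (const c)
    show ?case using S_monom[of c "(0, 0)"] by (simp add: qmonom_def)
  qed (auto intro: x y S_add)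
  then show ?thesis by (simp add: S_def)
qed

text \<open>Spanning meets independence: an element is congruent to a combination of monomials whose
  coefficients \<open>nf\<close> reads off. Hence \<open>nf\<close> decides equality in R, and all
  later computations compare coefficient families.\<close>

lemma qweyl_ideal_iff: "f \<in> qweyl_ideal q \<longleftrightarrow> nf q f = (\<lambda>_. 0)"
proof
  assume f: "nf q f = (\<lambda>_. 0)"
  obtain c where c: "f - from_coeffs c \<in> qweyl_ideal q" using ex_from_coeffs by blast
  have "Poly_Mapping.lookup c p = 0" for p
    using nf_ideal[OF c, of p] f by (simp add: nf_diff nf_from_coeffs)
  then have "c = 0" by (intro poly_mapping_eqI) simp
  then show "f \<in> qweyl_ideal q" using c by (simp add: from_coeffs_def)
qed (auto simp: nf_ideal)

lemma qweyl_ideal_diff_iff: "f - g \<in> qweyl_ideal q \<longleftrightarrow> nf q f = nf q g"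
  by (auto simp: qweyl_ideal_iff nf_diff fun_eq_iff)

text \<open>Equality of \<open>nf\<close> is congruence modulo a two-sided ideal, so representatives
  may be exchanged inside products.\<close>

lemma nf_mult_cong:
  assumes "nf q f = nf q f'" "nf q g = nf q g'"
  shows "nf q (f * g) = nf q (f' * g')"
proof -
  have "(f - f') * g + f' * (g - g') \<in> qweyl_ideal q"
    using assms by (intro qI_closed(2)[OF qI_closed(4) qI_closed(3)]) (simp_all add: qweyl_ideal_diff_iff)
  then have "f * g - f' * g' \<in> qweyl_ideal q" by (simp add: algebra_simps)
  then show ?thesis by (simp add: qweyl_ideal_diff_iff)
qed

lemma finite_nf: "finite {p. nf q f p \<noteq> 0}"
proof -
  obtain c where "f - from_coeffs c \<in> qweyl_ideal q" using ex_from_coeffs by blast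
  then have "nf q f = Poly_Mapping.lookup c"
    by (auto simp: qweyl_ideal_diff_iff nf_from_coeffs fun_eq_iff)
  then show ?thesis by simp
qed

lemma nf_rel: "nf q (free_y * free_x) = nf q (free_const q * free_x * free_y + 1)"
  using qweyl_rel_in[of q] unfolding qweyl_rel_def qweyl_ideal_diff_iff .

section \<open>The quotient ring\<close>

lemma qcls_eq: "qcls q f = {g. nf q g = nf q f}"
proof -
  have "qcls q f = {i + f | i. i \<in> qweyl_ideal q}"
    by (auto simp: qcls_def a_r_coset_def' free_ring_simps)
  also have "\<dots> = {g. g - f \<in> qweyl_ideal q}"
    by (force intro: exI[of _ "_ - f"])
  finally show ?thesis by (simp add: qweyl_ideal_diff_iff)
qed

lemma qcls_eq_iff: "qcls q f = qcls q g \<longleftrightarrow> nf q f = nf q g"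
  by (auto simp: qcls_eq)

lemma ring_qweyl: "ring (qweyl q)"
  unfolding qweyl_def by (rule ideal.quotient_is_ring[OF ideal_qweyl_ideal])

lemma carrier_qweyl: "carrier (qweyl q) = range (qcls q)"
  by (auto simp: qweyl_def FactRing_def A_RCOSETS_def' free_ring_simps qcls_def)

lemma qcls_carrier [simp]: "qcls q f \<in> carrier (qweyl q)"
  by (simp add: carrier_qweyl)

lemma qcls_cases: "A \<in> carrier (qweyl q) \<Longrightarrow> (\<And>f. A = qcls q f \<Longrightarrow> P) \<Longrightarrow> P"
  by (auto simp: carrier_qweyl)

lemma qcls_hom: "qcls q \<in> ring_hom free_ring (qweyl q)"
proof -
  have "qcls q = (+>\<^bsub>free_ring\<^esub>) (qweyl_ideal q)" by (simp add: qcls_def fun_eq_iff)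
  then show ?thesis
    unfolding qweyl_def using ideal.rcos_ring_hom[OF ideal_qweyl_ideal] by simp
qed

lemma qcls_mult [simp]: "qcls q f \<otimes>\<^bsub>qweyl q\<^esub> qcls q g = qcls q (f * g)"
  using ring_hom_mult[OF qcls_hom, of f g] by (simp add: free_ring_simps)

lemma qcls_add [simp]: "qcls q f \<oplus>\<^bsub>qweyl q\<^esub> qcls q g = qcls q (f + g)"
  using ring_hom_add[OF qcls_hom, of f g] by (simp add: free_ring_simps)

lemma qcls_one [simp]: "\<one>\<^bsub>qweyl q\<^esub> = qcls q 1"
  using ring_hom_one[OF qcls_hom, of q] by (simp add: free_ring_simps)

lemma qcls_zero [simp]: "\<zero>\<^bsub>qweyl q\<^esub> = qcls q 0"
  by (simp add: qweyl_def FactRing_def qcls_def free_ring_simps a_r_coset_def')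

lemma qcls_uminus [simp]: "\<ominus>\<^bsub>qweyl q\<^esub> qcls q f = qcls q (- f)"
proof -
  interpret R: ring "qweyl q" by (rule ring_qweyl)
  show ?thesis by (rule R.minus_equality) simp_all
qed

lemma qcls_minus [simp]: "qcls q f \<ominus>\<^bsub>qweyl q\<^esub> qcls q g = qcls q (f - g)"
  by (simp add: a_minus_def)

lemma qcls_pow [simp]: "qcls q f [^]\<^bsub>qweyl q\<^esub> (n::nat) = qcls q (f ^ n)"
proof -
  interpret R: ring "qweyl q" by (rule ring_qweyl)
  show ?thesis by (induction n) (simp_all add: power_Suc2 del: power_Suc)
qed

lemma smul_qcls [simp]: "smul q c (qcls q f) = qcls q (free_const c * f)"
  by (simp add: smul_def)

lemma qcls_finsum: "finite A \<Longrightarrow> (\<Oplus>\<^bsub>qweyl q\<^esub>i\<in>A. qcls q (F i)) = qcls q (\<Sum>i\<in>A. F i)"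
proof (induction A rule: finite_induct)
  case (insert x A)
  interpret R: ring "qweyl q" by (rule ring_qweyl)
  show ?case using insert by (simp add: R.finsum_insert)
next
  case empty
  interpret R: ring "qweyl q" by (rule ring_qweyl)
  show ?case by simp
qed

lemma xy_sum_qcls: "xy_sum q c = qcls q (from_coeffs c)"
  by (simp add: xy_sum_def Rx_def Ry_def qcls_finsum from_coeffs_def qmonom_def)

lemma poly_at_qcls:
  "poly_at q p (qcls q f) = qcls q (\<Sum>n\<le>Polynomial.degree p. free_const (Polynomial.coeff p n) * f ^ n)"
  by (simp add: poly_at_def qcls_finsum)

section \<open>Diagonal automorphisms\<close>

text \<open>\<open>left_x\<close> lowers the weight j - i by 1 and both terms of
  \<open>left_y\<close> raise it by 1, in step with the scalars that \<open>diag_hom\<close>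
  attaches to x and y.\<close>

lemma nf_diag_hom:
  assumes "\<beta> \<noteq> 0"
  shows "nf q (diag_hom \<beta> f) (i, j) = \<beta> powi (int j - int i) * nf q f (i, j)"
proof (induction f arbitrary: i j rule: free_induct)
  case (const c)
  show ?case by (auto simp: nf_const)
next
  case (x f)
  have "\<beta> powi (int j - int (Suc k)) * \<beta> = \<beta> powi (int j - int k)" for k
    using assms by (simp add: power_int_diff power_int_add)
  with x assms show ?case
    by (cases i) (auto simp: mult.assoc nf_scale nf_left_x left_x_def field_simps)
next
  case (y f)
  have "\<beta> powi (int j - int (Suc i)) * \<beta> = \<beta> powi (int j - int i)"
    "\<beta> powi (1 + int k - int i) = \<beta> * \<beta> powi (int k - int i)" for k
    using assms by (simp_all add: power_int_diff power_int_add)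
  with y assms show ?case
    by (cases j) (auto simp: mult.assoc nf_scale nf_left_y left_y_def algebra_simps)
next
  case (add f g)
  then show ?case by (simp add: nf_add algebra_simps)
qed

text \<open>Evaluates \<open>F\<close> on an arbitrary representative, so it is meaningful only for
  \<open>F\<close> compatible with the ideal, as \<open>qlift_qcls\<close> requires.\<close>

definition qlift :: "'k::field \<Rightarrow> ('k free \<Rightarrow> 'k free) \<Rightarrow> 'k free set \<Rightarrow> 'k free set" where
  "qlift q F = (\<lambda>A\<in>carrier (qweyl q). qcls q (F (SOME f. A = qcls q f)))"

lemma qlift_qcls:
  assumes "\<And>f g. nf q f = nf q g \<Longrightarrow> nf q (F f) = nf q (F g)"
  shows "qlift q F (qcls q f) = qcls q (F f)"
proof -
  have "qcls q f = qcls q (SOME g. qcls q f = qcls q g)"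
    by (rule someI[of "\<lambda>g. qcls q f = qcls q g" f]) simp
  then have "nf q (F (SOME g. qcls q f = qcls q g)) = nf q (F f)"
    by (intro assms) (simp add: qcls_eq_iff)
  then show ?thesis by (simp add: qlift_def qcls_eq_iff)
qed

lemma nf_diag_hom_cong:
  assumes "\<beta> \<noteq> 0" "nf q f = nf q g"
  shows "nf q (diag_hom \<beta> f) = nf q (diag_hom \<beta> g)"
  by (rule nf_eqI) (simp add: nf_diag_hom assms)

lemma nf_diag_hom_diag_hom:
  assumes "\<beta> \<noteq> 0" "\<gamma> \<noteq> 0"
  shows "nf q (diag_hom \<beta> (diag_hom \<gamma> f)) = nf q (diag_hom (\<beta> * \<gamma>) f)"
  by (rule nf_eqI) (simp add: nf_diag_hom assms power_int_mult_distrib)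

lemma nf_diag_hom_1: "nf q (diag_hom 1 f) = nf q f"
  by (rule nf_eqI) (simp add: nf_diag_hom)

lemma qlift_diag_hom:
  "\<beta> \<noteq> 0 \<Longrightarrow> qlift q (diag_hom \<beta>) (qcls q f) = qcls q (diag_hom \<beta> f)"
  by (rule qlift_qcls) (rule nf_diag_hom_cong)

lemma AutI:
  assumes "f \<in> extensional (carrier (qweyl q))" "bij_betw f (carrier (qweyl q)) (carrier (qweyl q))"
    "f (qcls q 1) = qcls q 1"
    "\<And>a b. f (qcls q (a + b)) = f (qcls q a) \<oplus>\<^bsub>qweyl q\<^esub> f (qcls q b)"
    "\<And>a b. f (qcls q (a * b)) = f (qcls q a) \<otimes>\<^bsub>qweyl q\<^esub> f (qcls q b)"
    "\<And>c a. f (qcls q (free_const c * a)) = smul q c (f (qcls q a))"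
  shows "f \<in> Aut q"
  using assms bij_betwE[OF assms(2)]
  by (auto simp: Aut_def Bij_def ring_hom_def klinear_def carrier_qweyl)

lemma Aut_simps:
  assumes "f \<in> Aut q"
  shows "f (qcls q 1) = qcls q 1"
    "f (qcls q (a + b)) = f (qcls q a) \<oplus>\<^bsub>qweyl q\<^esub> f (qcls q b)"
    "f (qcls q (a * b)) = f (qcls q a) \<otimes>\<^bsub>qweyl q\<^esub> f (qcls q b)"
    "f (qcls q (free_const c * a)) = smul q c (f (qcls q a))"
proof -
  have lin: "\<forall>A\<in>carrier (qweyl q). f (smul q c A) = smul q c (f A)"
    using assms by (auto simp: Aut_def klinear_def)
  show "f (qcls q (free_const c * a)) = smul q c (f (qcls q a))"
    using bspec[OF lin, of "qcls q a"] by simp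
qed (use assms in \<open>auto simp: Aut_def ring_hom_def carrier_qweyl
      simp flip: qcls_add qcls_mult qcls_one\<close>)

lemma Aut_extensional: "f \<in> Aut q \<Longrightarrow> f \<in> extensional (carrier (qweyl q))"
  by (auto simp: Aut_def Bij_def)

lemma Aut_closed: "f \<in> Aut q \<Longrightarrow> a \<in> carrier (qweyl q) \<Longrightarrow> f a \<in> carrier (qweyl q)"
  by (auto simp: Aut_def ring_hom_def)

lemma Aut_eqI:
  assumes f: "f \<in> Aut q" and g: "g \<in> Aut q" and eq: "f (Rx q) = g (Rx q)" "f (Ry q) = g (Ry q)"
  shows "f = g"
proof (rule extensionalityI[OF Aut_extensional[OF f] Aut_extensional[OF g]])
  fix a assume "a \<in> carrier (qweyl q)"
  then obtain s where a: "a = qcls q s" by (rule qcls_cases)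
  show "f a = g a" unfolding a
  proof (induction s rule: free_induct)
    case (const c)
    show ?case
      using Aut_simps(4)[OF f, of c 1] Aut_simps(4)[OF g, of c 1]
      by (simp add: Aut_simps(1)[OF f] Aut_simps(1)[OF g])
  qed (use eq in \<open>simp_all add: Aut_simps[OF f] Aut_simps[OF g] Rx_def Ry_def\<close>)
qed

lemma qlift_diag_hom_Aut:
  assumes "\<beta> \<noteq> 0"
  shows "qlift q (diag_hom \<beta>) \<in> Aut q"
proof (rule AutI)
  show "bij_betw (qlift q (diag_hom \<beta>)) (carrier (qweyl q)) (carrier (qweyl q))"
    by (rule bij_betw_byWitness[where f' = "qlift q (diag_hom (inverse \<beta>))"])
       (use assms in \<open>auto simp: carrier_qweyl qlift_diag_hom qcls_eq_iff nf_diag_hom_diag_hom nf_diag_hom_1\<close>)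
qed (use assms in \<open>simp_all add: qlift_diag_hom, simp add: qlift_def\<close>)

text \<open>Justifies the definite description in \<open>rho\<close>: the lifted
  \<open>diag_hom\<close> is an automorphism with these values, and automorphisms agreeing on the
  generators are equal.\<close>

lemma rho_eq:
  assumes "\<beta> \<noteq> 0"
  shows "rho q \<beta> = qlift q (diag_hom \<beta>)"
  unfolding rho_def
proof (rule the_equality)
  show *: "qlift q (diag_hom \<beta>) \<in> Aut q \<and> qlift q (diag_hom \<beta>) (Rx q) = smul q (inverse \<beta>) (Rx q) \<and>
    qlift q (diag_hom \<beta>) (Ry q) = smul q \<beta> (Ry q)"
    using assms by (simp add: qlift_diag_hom_Aut qlift_diag_hom Rx_def Ry_def)
  fix f
  assume "f \<in> Aut q \<and> f (Rx q) = smul q (inverse \<beta>) (Rx q) \<and> f (Ry q) = smul q \<beta> (Ry q)"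
  with * show "f = qlift q (diag_hom \<beta>)" by (metis Aut_eqI)
qed

lemma rho_qcls: "\<beta> \<noteq> 0 \<Longrightarrow> rho q \<beta> (qcls q f) = qcls q (diag_hom \<beta> f)"
  by (simp add: rho_eq qlift_diag_hom)

lemma rho_Aut: "\<beta> \<noteq> 0 \<Longrightarrow> rho q \<beta> \<in> Aut q"
  by (simp add: rho_eq qlift_diag_hom_Aut)

section \<open>Skew derivations from their values on the generators\<close>

text \<open>The equation obtained by applying a skew derivation with values \<open>u\<close>,
  \<open>v\<close> to both sides of yx = qxy + 1.\<close>

definition der_compat :: "'k::field \<Rightarrow> 'k \<Rightarrow> 'k free \<Rightarrow> 'k free \<Rightarrow> bool" where
  "der_compat q \<mu> u v \<longleftrightarrow> nf q (v * free_x + free_const \<mu> * (free_y * u))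
     = nf q (free_const q * (u * free_y + free_const (inverse \<mu>) * (free_x * v)))"

text \<open>The ideal elements whose derivative lies in the ideal again form an ideal, and
  compatibility puts the relation into it.\<close>

lemma nf_free_der_cong:
  assumes "\<mu> \<noteq> 0" "der_compat q \<mu> u v" "nf q f = nf q g"
  shows "nf q (free_der \<mu> u v f) = nf q (free_der \<mu> u v g)"
proof -
  \<comment> \<open>Membership of \<open>f\<close> itself is kept because the Leibniz rule for a
    product also contains \<open>f\<close> times a factor and its twist times a derivative.\<close>
  let ?J = "{f \<in> qweyl_ideal q. free_der \<mu> u v f \<in> qweyl_ideal q}"
  have diag: "diag_hom \<mu> f \<in> qweyl_ideal q" if "f \<in> qweyl_ideal q" for f
    using nf_diag_hom_cong[OF assms(1), of q f 0] that by (simp add: qweyl_ideal_iff fun_eq_iff)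
  have "ideal ?J free_ring"
  proof (rule free_idealI)
    show "0 \<in> ?J" using free_der_scale[of \<mu> u v 0 0] by (simp add: qI_closed)
    fix a r assume "a \<in> ?J"
    then show "r * a \<in> ?J" "a * r \<in> ?J"
      by (simp_all add: free_der_mult qI_closed(2-4) diag)
  qed (simp add: free_der_add qI_closed(2))
  moreover have "qweyl_rel q \<in> ?J"
  proof -
    have neg: "free_der \<mu> u v (f - g) = free_der \<mu> u v f - free_der \<mu> u v g" for f g
      using free_der_add[of \<mu> u v "f - g" g] by simp
    have "free_der \<mu> u v (qweyl_rel q) = (v * free_x + free_const \<mu> * (free_y * u))
        - free_const q * (u * free_y + free_const (inverse \<mu>) * (free_x * v))"
      using free_der_const[of \<mu> u v 1]
      by (simp add: qweyl_rel_def neg free_der_add free_der_mult mult.assoc distrib_left)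
    then show ?thesis
      using assms(2) by (simp add: qweyl_rel_in qweyl_ideal_diff_iff der_compat_def)
  qed
  ultimately have sub: "qweyl_ideal q \<subseteq> ?J" by (rule qweyl_ideal_minimal)
  have "f - g \<in> ?J" using assms(3) sub by (auto simp: qweyl_ideal_diff_iff[symmetric])
  moreover have "free_der \<mu> u v f = free_der \<mu> u v (f - g) + free_der \<mu> u v g"
    by (simp flip: free_der_add)
  ultimately show ?thesis by (simp flip: qweyl_ideal_diff_iff)
qed

lemma DerI:
  assumes "\<mu> \<noteq> 0" "d \<in> extensional (carrier (qweyl q))"
    "\<And>a. d (qcls q a) \<in> carrier (qweyl q)"
    "\<And>a b. d (qcls q (a + b)) = d (qcls q a) \<oplus>\<^bsub>qweyl q\<^esub> d (qcls q b)"
    "\<And>c a. d (qcls q (free_const c * a)) = smul q c (d (qcls q a))"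
    "\<And>a b. d (qcls q (a * b)) = d (qcls q a) \<otimes>\<^bsub>qweyl q\<^esub> qcls q b
       \<oplus>\<^bsub>qweyl q\<^esub> qcls q (diag_hom \<mu> a) \<otimes>\<^bsub>qweyl q\<^esub> d (qcls q b)"
  shows "d \<in> Der q \<mu>"
  using assms by (auto simp: Der_def klinear_def carrier_qweyl PiE_def rho_qcls)

lemma Der_simps:
  assumes "\<mu> \<noteq> 0" "d \<in> Der q \<mu>"
  shows "d (qcls q a) \<in> carrier (qweyl q)"
    "d (qcls q (a + b)) = d (qcls q a) \<oplus>\<^bsub>qweyl q\<^esub> d (qcls q b)"
    "d (qcls q (free_const c * a)) = smul q c (d (qcls q a))"
    "d (qcls q (a * b)) = d (qcls q a) \<otimes>\<^bsub>qweyl q\<^esub> qcls q b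
       \<oplus>\<^bsub>qweyl q\<^esub> qcls q (diag_hom \<mu> a) \<otimes>\<^bsub>qweyl q\<^esub> d (qcls q b)"
proof -
  have "\<forall>x\<in>carrier (qweyl q). d x \<in> carrier (qweyl q)" using assms(2) by (auto simp: Der_def)
  then show "d (qcls q a) \<in> carrier (qweyl q)" by simp
  show "d (qcls q (a + b)) = d (qcls q a) \<oplus>\<^bsub>qweyl q\<^esub> d (qcls q b)"
    using assms by (auto simp: Der_def klinear_def carrier_qweyl)
  show "d (qcls q (free_const c * a)) = smul q c (d (qcls q a))"
    using assms by (auto simp: Der_def klinear_def carrier_qweyl)
  show "d (qcls q (a * b)) = d (qcls q a) \<otimes>\<^bsub>qweyl q\<^esub> qcls q b
       \<oplus>\<^bsub>qweyl q\<^esub> qcls q (diag_hom \<mu> a) \<otimes>\<^bsub>qweyl q\<^esub> d (qcls q b)"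
    using assms by (auto simp: Der_def carrier_qweyl rho_qcls)
qed

lemma Der_extensional: "d \<in> Der q \<mu> \<Longrightarrow> d \<in> extensional (carrier (qweyl q))"
  by (auto simp: Der_def PiE_def)

lemma Der_const:
  assumes "\<mu> \<noteq> 0" "d \<in> Der q \<mu>"
  shows "d (qcls q (free_const c)) = qcls q 0"
proof -
  obtain u where u: "d (qcls q 1) = qcls q u"
    using Der_simps(1)[OF assms] by (rule qcls_cases)
  have "nf q u = nf q (u + u)"
    using Der_simps(4)[OF assms, of 1 1] by (simp add: u qcls_eq_iff)
  then have "nf q u p = nf q u p + nf q u p" for p by (metis nf_add)
  then have "nf q u = nf q 0" by (metis add_cancel_right_left ext nf_0)
  then have "d (qcls q 1) = qcls q 0" by (simp add: u qcls_eq_iff)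
  then show ?thesis using Der_simps(3)[OF assms, of c 1] by simp
qed

lemma Der_eqI:
  assumes \<mu>: "\<mu> \<noteq> 0" and d: "d \<in> Der q \<mu>" and e: "e \<in> Der q \<mu>"
    and eq: "d (Rx q) = e (Rx q)" "d (Ry q) = e (Ry q)"
  shows "d = e"
proof (rule extensionalityI[OF Der_extensional[OF d] Der_extensional[OF e]])
  fix a assume "a \<in> carrier (qweyl q)"
  then obtain s where a: "a = qcls q s" by (rule qcls_cases)
  show "d a = e a" unfolding a
    by (induction s rule: free_induct)
       (use eq in \<open>simp_all add: Der_const[OF \<mu> d] Der_const[OF \<mu> e]
          Der_simps[OF \<mu> d] Der_simps[OF \<mu> e] Rx_def Ry_def\<close>)
qed

lemma der_on_gens_eq:
  assumes \<mu>: "\<mu> \<noteq> 0" and d: "d \<in> Der q \<mu>" "d (Rx q) = u" "d (Ry q) = v"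
  shows "der_on_gens q \<mu> u v = d"
  unfolding der_on_gens_def
  by (rule the_equality) (use assms in \<open>auto intro: Der_eqI\<close>)

lemma qlift_free_der:
  assumes "\<mu> \<noteq> 0" "der_compat q \<mu> u v"
  shows "qlift q (free_der \<mu> u v) (qcls q f) = qcls q (free_der \<mu> u v f)"
  by (rule qlift_qcls) (rule nf_free_der_cong[OF assms])

lemma qlift_free_der_Der:
  assumes "\<mu> \<noteq> 0" "der_compat q \<mu> u v"
  shows "qlift q (free_der \<mu> u v) \<in> Der q \<mu>"
  by (rule DerI) (use assms in \<open>simp_all add: qlift_free_der free_der_add free_der_scale free_der_mult,
      simp add: qlift_def\<close>)

lemma der_on_gens_Der:
  assumes "\<mu> \<noteq> 0" "der_compat q \<mu> u v"
  shows "der_on_gens q \<mu> (qcls q u) (qcls q v) \<in> Der q \<mu>"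
    and "der_on_gens q \<mu> (qcls q u) (qcls q v) (Rx q) = qcls q u"
    and "der_on_gens q \<mu> (qcls q u) (qcls q v) (Ry q) = qcls q v"
proof -
  have "der_on_gens q \<mu> (qcls q u) (qcls q v) = qlift q (free_der \<mu> u v)"
    by (rule der_on_gens_eq) (use assms in \<open>simp_all add: qlift_free_der_Der qlift_free_der Rx_def Ry_def\<close>)
  then show "der_on_gens q \<mu> (qcls q u) (qcls q v) \<in> Der q \<mu>"
    and "der_on_gens q \<mu> (qcls q u) (qcls q v) (Rx q) = qcls q u"
    and "der_on_gens q \<mu> (qcls q u) (qcls q v) (Ry q) = qcls q v"
    using assms by (simp_all add: qlift_free_der_Der qlift_free_der Rx_def Ry_def)
qed

section \<open>Leading monomials\<close>

definition lex_le :: "nat \<times> nat \<Rightarrow> nat \<times> nat \<Rightarrow> bool" where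
  "lex_le s p \<longleftrightarrow> snd s < snd p \<or> snd s = snd p \<and> fst s \<le> fst p"

text \<open>Only an upper bound: the coefficient at \<open>p\<close> may vanish, so bounds pass
  through products without a case distinction.\<close>

definition lead_bound :: "'k::field \<Rightarrow> nat \<times> nat \<Rightarrow> 'k free \<Rightarrow> bool" where
  "lead_bound q p f \<longleftrightarrow> (\<forall>s. nf q f s \<noteq> 0 \<longrightarrow> lex_le s p)"

lemma lead_boundD: "lead_bound q p f \<Longrightarrow> \<not> lex_le s p \<Longrightarrow> nf q f s = 0"
  unfolding lead_bound_def by blast

lemma lead_x_mult:
  assumes "lead_bound q (a, b) g"
  shows "lead_bound q (Suc a, b) (free_x * g)" "nf q (free_x * g) (Suc a, b) = nf q g (a, b)"
proof -
  have "nf q (free_x * g) (i, j) = 0" if "\<not> lex_le (i, j) (Suc a, b)" for i j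
    using that lead_boundD[OF assms, of "(i - 1, j)"]
    by (cases i) (auto simp: nf_left_x left_x_def lex_le_def)
  then show "lead_bound q (Suc a, b) (free_x * g)" by (auto simp: lead_bound_def)
  show "nf q (free_x * g) (Suc a, b) = nf q g (a, b)"
    by (simp add: nf_left_x left_x_def)
qed

lemma lead_y_mult:
  assumes "lead_bound q (a, b) g"
  shows "lead_bound q (a, Suc b) (free_y * g)" "nf q (free_y * g) (a, Suc b) = q ^ a * nf q g (a, b)"
proof -
  have "nf q (free_y * g) (i, j) = 0" if "\<not> lex_le (i, j) (a, Suc b)" for i j
    using that lead_boundD[OF assms, of "(i, j - 1)"] lead_boundD[OF assms, of "(Suc i, j)"]
    by (cases j) (auto simp: nf_left_y left_y_def lex_le_def)
  then show "lead_bound q (a, Suc b) (free_y * g)" by (auto simp: lead_bound_def)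
  show "nf q (free_y * g) (a, Suc b) = q ^ a * nf q g (a, b)"
    using lead_boundD[OF assms, of "(Suc a, Suc b)"]
    by (simp add: nf_left_y left_y_def lex_le_def)
qed

text \<open>The power of q comes from moving y^j past x^a; the correction terms are smaller in the
  order.\<close>

lemma lead_qmonom_mult:
  assumes "lead_bound q (a, b) g"
  shows "lead_bound q (a + i, b + j) (qmonom (i, j) * g)
    \<and> nf q (qmonom (i, j) * g) (a + i, b + j) = q ^ (a * j) * nf q g (a, b)"
proof -
  have y: "lead_bound q (a, b + j) (free_y ^ j * g)
    \<and> nf q (free_y ^ j * g) (a, b + j) = q ^ (a * j) * nf q g (a, b)"
    by (induction j) (use assms in \<open>simp_all add: mult.assoc lead_y_mult power_add\<close>)
  have "lead_bound q (a + i, b + j) (free_x ^ i * (free_y ^ j * g))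
    \<and> nf q (free_x ^ i * (free_y ^ j * g)) (a + i, b + j) = q ^ (a * j) * nf q g (a, b)"
    by (induction i) (use y in \<open>simp_all add: mult.assoc lead_x_mult\<close>)
  then show ?thesis by (simp add: qmonom_def mult.assoc)
qed

lemma nf_obtain_coeffs:
  obtains c where "nf q f = nf q (from_coeffs c)" "nf q f = Poly_Mapping.lookup c"
proof -
  obtain c where "f - from_coeffs c \<in> qweyl_ideal q" using ex_from_coeffs by blast
  then have "nf q f = nf q (from_coeffs c)" by (simp add: qweyl_ideal_diff_iff)
  with that show ?thesis by (auto simp: nf_from_coeffs fun_eq_iff)
qed

text \<open>Expanding \<open>f\<close> into monomials, only its leading one can contribute to the
  exponent (a + i, b + j).\<close>

lemma lead_mult:
  assumes f: "lead_bound q (i, j) f" and g: "lead_bound q (a, b) g"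
  shows "lead_bound q (a + i, b + j) (f * g)"
    and "nf q (f * g) (a + i, b + j) = q ^ (a * j) * nf q f (i, j) * nf q g (a, b)"
proof -
  obtain c where c: "nf q f = nf q (from_coeffs c)" "nf q f = Poly_Mapping.lookup c"
    by (rule nf_obtain_coeffs)
  have "nf q (f * g) = nf q (from_coeffs c * g)" using c by (intro nf_mult_cong) simp_all
  then have nf: "nf q (f * g) s =
      (\<Sum>p\<in>Poly_Mapping.keys c. Poly_Mapping.lookup c p * nf q (qmonom p * g) s)" for s
    by (simp add: from_coeffs_def sum_distrib_right nf_sum nf_scale mult.assoc)
  have keys: "lex_le p (i, j)" if "p \<in> Poly_Mapping.keys c" for p
    using f that c(2) unfolding lead_bound_def in_keys_iff by metis
  have bound: "nf q (qmonom p * g) s = 0" if "\<not> lex_le s (a + fst p, b + snd p)" for s p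
    using lead_qmonom_mult[OF g, of "fst p" "snd p"] that
    by (cases p) (auto dest: lead_boundD)
  have "nf q (f * g) s = 0" if s: "\<not> lex_le s (a + i, b + j)" for s
  proof -
    have "nf q (qmonom p * g) s = 0" if "p \<in> Poly_Mapping.keys c" for p
      using keys[OF that] s by (intro bound) (auto simp: lex_le_def)
    then show ?thesis by (simp add: nf)
  qed
  then show "lead_bound q (a + i, b + j) (f * g)" by (auto simp: lead_bound_def)
  \<comment> \<open>The order is compatible with adding exponents, so a strictly smaller monomial of
    \<open>f\<close> gives a product bounded strictly below the target.\<close>
  have "nf q (qmonom p * g) (a + i, b + j) = 0" if "p \<in> Poly_Mapping.keys c - {(i, j)}" for p
    using keys[of p] that by (intro bound) (cases p, auto simp: lex_le_def)
  then have "nf q (f * g) (a + i, b + j) = (\<Sum>p\<in>Poly_Mapping.keys c.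
      if (i, j) = p then Poly_Mapping.lookup c (i, j) * nf q (qmonom (i, j) * g) (a + i, b + j) else 0)"
    unfolding nf by (intro sum.cong) auto
  also have "\<dots> = Poly_Mapping.lookup c (i, j) * nf q (qmonom (i, j) * g) (a + i, b + j)"
    by (simp add: in_keys_iff)
  also have "\<dots> = q ^ (a * j) * nf q f (i, j) * nf q g (a, b)"
    using lead_qmonom_mult[OF g, of i j] by (simp add: c(2))
  finally show "nf q (f * g) (a + i, b + j) = q ^ (a * j) * nf q f (i, j) * nf q g (a, b)" .
qed

lemma lead_exists:
  assumes "nf q f \<noteq> (\<lambda>_. 0)"
  obtains i j where "lead_bound q (i, j) f" "nf q f (i, j) \<noteq> 0"
proof -
  let ?S = "{p. nf q f p \<noteq> 0}"
  define j where "j = Max (snd ` ?S)"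
  define i where "i = Max (fst ` {p \<in> ?S. snd p = j})"
  have fin: "finite ?S" by (rule finite_nf)
  have "?S \<noteq> {}" using assms by (auto simp: fun_eq_iff)
  then have "j \<in> snd ` ?S" unfolding j_def using fin by (intro Max_in) auto
  then have ne: "fst ` {p \<in> ?S. snd p = j} \<noteq> {}" by auto
  have fin': "finite (fst ` {p \<in> ?S. snd p = j})" using fin by auto
  have "i \<in> fst ` {p \<in> ?S. snd p = j}" unfolding i_def using ne fin' by (intro Max_in)
  then have "nf q f (i, j) \<noteq> 0" by auto
  moreover have "lead_bound q (i, j) f"
    unfolding lead_bound_def
  proof (intro allI impI)
    fix s assume s: "nf q f s \<noteq> 0"
    then have "snd s \<le> j" unfolding j_def using fin by (intro Max_ge) auto
    moreover have "fst s \<le> i" if "snd s = j"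
      unfolding i_def using fin' s that by (intro Max_ge) auto
    ultimately show "lex_le s (i, j)" by (auto simp: lex_le_def)
  qed
  ultimately show ?thesis using that by blast
qed

lemma lead_unique:
  assumes "lead_bound q p f" "nf q f p \<noteq> 0" "lead_bound q s f" "nf q f s \<noteq> 0"
  shows "p = s"
  using assms by (cases p; cases s) (force simp: lead_bound_def lex_le_def)

lemma nf_mult_eq_0:
  assumes "q \<noteq> 0" "nf q (f * g) = (\<lambda>_. 0)" "nf q f \<noteq> (\<lambda>_. 0)"
  shows "nf q g = (\<lambda>_. 0)"
proof (rule ccontr)
  assume "nf q g \<noteq> (\<lambda>_. 0)"
  then obtain a b where g: "lead_bound q (a, b) g" "nf q g (a, b) \<noteq> 0" by (rule lead_exists)
  obtain i j where f: "lead_bound q (i, j) f" "nf q f (i, j) \<noteq> 0"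
    using assms(3) by (rule lead_exists)
  show False using lead_mult(2)[OF f(1) g(1)] assms(1,2) f(2) g(2) by simp
qed

text \<open>Leading exponents add up to that of 1, so \<open>u\<close> has leading exponent (0, 0),
  the least one in the order, and is a scalar.\<close>

lemma nf_unit_const:
  assumes q: "q \<noteq> 0" and uv: "nf q (u * v) = nf q 1"
  obtains c where "c \<noteq> 0" "nf q u = nf q (free_const c)"
proof -
  have "nf q (u * v) (0, 0) = 1" by (simp add: uv nf_1)
  then have "nf q u \<noteq> nf q 0" "nf q v \<noteq> nf q 0"
    using nf_mult_cong[of q u 0 v v] nf_mult_cong[of q u u v 0] by auto
  then have ne: "nf q u \<noteq> (\<lambda>_. 0)" "nf q v \<noteq> (\<lambda>_. 0)" by (auto simp: fun_eq_iff)
  obtain i j where u: "lead_bound q (i, j) u" "nf q u (i, j) \<noteq> 0"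
    using ne(1) by (rule lead_exists)
  obtain a b where v: "lead_bound q (a, b) v" "nf q v (a, b) \<noteq> 0"
    using ne(2) by (rule lead_exists)
  have "nf q (u * v) (a + i, b + j) \<noteq> 0"
    using lead_mult(2)[OF u(1) v(1)] u(2) v(2) q by simp
  then have "i = 0" "j = 0" by (auto simp: uv nf_1 split: if_splits)
  then have "nf q u s = 0" if "s \<noteq> (0, 0)" for s
    using u(1) that by (cases s) (auto simp: lead_bound_def lex_le_def)
  then have "nf q u = nf q (free_const (nf q u (0, 0)))"
    by (auto simp: nf_const fun_eq_iff)
  with u(2) \<open>i = 0\<close> \<open>j = 0\<close> show ?thesis by (intro that) auto
qed

section \<open>The normal element\<close>

definition h_free :: "'k::field \<Rightarrow> 'k free" where
  "h_free q = 1 - free_const (1 - q) * (free_y * free_x)"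

lemma h_elt_qcls: "h_elt q = qcls q (h_free q)"
  by (simp add: h_elt_def h_free_def Rx_def Ry_def)

lemma nf_x: "nf q free_x p = (if p = (1, 0) then 1 else 0)"
  using nf_monom[of q "(1, 0)"] by (simp add: qmonom_def)

lemma nf_y: "nf q free_y p = (if p = (0, 1) then 1 else 0)"
  using nf_monom[of q "(0, 1)"] by (simp add: qmonom_def)

lemma nf_xy: "nf q (free_x * free_y) p = (if p = (1, 1) then 1 else 0)"
  using nf_monom[of q "(1, 1)"] by (simp add: qmonom_def)

lemma nf_yx: "nf q (free_y * free_x) p = (if p = (0, 0) then 1 else if p = (1, 1) then q else 0)"
  by (auto simp: nf_rel nf_add nf_scale nf_xy nf_1 mult.assoc)

lemma nf_h_free: "nf q (h_free q) p = (if p = (0, 0) then q else if p = (1, 1) then (q - 1) * q else 0)"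
  by (simp add: h_free_def nf_diff nf_scale nf_yx nf_1 algebra_simps)

text \<open>Being a multiple of a commutator is what gives control over the image of h under an
  automorphism.\<close>

lemma nf_h_commutator: "nf q (h_free q) = nf q (free_const q * (free_y * free_x - free_x * free_y))"
  by (auto simp: fun_eq_iff nf_h_free nf_scale nf_diff nf_yx nf_xy algebra_simps)

lemma nf_h_x: "nf q (h_free q * free_x) = nf q (free_const q * free_x * h_free q)"
  by (rule nf_eqI)
     (auto simp: nf_right_x nf_scale mult.assoc nf_left_x left_x_def right_x_def nf_h_free qnum_Suc algebra_simps)

lemma nf_h_y:
  assumes "q \<noteq> 0"
  shows "nf q (h_free q * free_y) = nf q (free_const (inverse q) * free_y * h_free q)"
  by (rule nf_eqI) (use assms in \<open>auto simp: nf_right_y nf_scale mult.assoc nf_left_y left_y_def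
      right_y_def nf_h_free qnum_Suc field_simps\<close>)

text \<open>h commutes with x and y up to the scalars q and 1/q, which are those of
  \<open>diag_hom (inverse q)\<close>; this extends multiplicatively.\<close>

lemma nf_h_normal:
  assumes q: "q \<noteq> 0"
  shows "nf q (h_free q * f) = nf q (diag_hom (inverse q) f * h_free q)"
proof (induction f rule: free_induct)
  case (const c)
  show ?case by (simp add: free_const_commute)
next
  case (x f)
  have "nf q ((h_free q * free_x) * f) = nf q ((free_const q * free_x * h_free q) * f)"
    by (intro nf_mult_cong nf_h_x refl)
  also have "\<dots> = nf q (free_const q * free_x * (diag_hom (inverse q) f * h_free q))"
    unfolding mult.assoc by (intro nf_mult_cong x refl)
  finally show ?case by (simp add: mult.assoc)
next
  case (y f)
  have "nf q ((h_free q * free_y) * f) = nf q ((free_const (inverse q) * free_y * h_free q) * f)"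
    by (intro nf_mult_cong nf_h_y refl q)
  also have "\<dots> = nf q (free_const (inverse q) * free_y * (diag_hom (inverse q) f * h_free q))"
    unfolding mult.assoc by (intro nf_mult_cong y refl)
  finally show ?case by (simp add: mult.assoc)
next
  case (add f g)
  then show ?case by (auto simp: fun_eq_iff distrib_left distrib_right nf_add)
qed

lemma nf_h_power_normal:
  assumes q: "q \<noteq> 0"
  shows "nf q (h_free q ^ n * f) = nf q (diag_hom (inverse q ^ n) f * h_free q ^ n)"
proof (induction n arbitrary: f)
  case 0
  show ?case using nf_diag_hom_1[of q f] by simp
next
  case (Suc n)
  have "nf q (h_free q ^ Suc n * f) = nf q (h_free q ^ n * (h_free q * f))"
    by (simp add: power_Suc2 mult.assoc del: power_Suc)
  also have "\<dots> = nf q (h_free q ^ n * (diag_hom (inverse q) f * h_free q))"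
    by (intro nf_mult_cong refl nf_h_normal q)
  also have "\<dots> = nf q (diag_hom (inverse q ^ n) (diag_hom (inverse q) f) * h_free q ^ n * h_free q)"
    unfolding mult.assoc[symmetric] by (intro nf_mult_cong refl Suc)
  also have "\<dots> = nf q (diag_hom (inverse q ^ n * inverse q) f * (h_free q ^ n * h_free q))"
    unfolding mult.assoc using q by (intro nf_mult_cong refl nf_diag_hom_diag_hom) auto
  finally show ?case by (simp add: power_Suc2 del: power_Suc)
qed

lemma nf_diag_hom_h:
  assumes "\<beta> \<noteq> 0"
  shows "nf q (diag_hom \<beta> (h_free q)) = nf q (h_free q)"
  by (rule nf_eqI) (auto simp: nf_diag_hom assms nf_h_free)

section \<open>The ideal hR and the commutators\<close>

definition h_multiples :: "'k::field \<Rightarrow> 'k free set" where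
  "h_multiples q = {f. \<exists>u. nf q f = nf q (h_free q * u)}"

lemma h_multiples_add: "f \<in> h_multiples q \<Longrightarrow> g \<in> h_multiples q \<Longrightarrow> f + g \<in> h_multiples q"
proof -
  assume "f \<in> h_multiples q" "g \<in> h_multiples q"
  then obtain u v where "nf q f = nf q (h_free q * u)" "nf q g = nf q (h_free q * v)"
    by (auto simp: h_multiples_def)
  then have "nf q (f + g) = nf q (h_free q * (u + v))"
    by (simp add: fun_eq_iff nf_add distrib_left)
  then show ?thesis by (auto simp: h_multiples_def)
qed

lemma h_multiples_right: "f \<in> h_multiples q \<Longrightarrow> f * r \<in> h_multiples q"
proof -
  assume "f \<in> h_multiples q"
  then obtain u where "nf q f = nf q (h_free q * u)" by (auto simp: h_multiples_def)
  then have "nf q (f * r) = nf q (h_free q * u * r)" by (intro nf_mult_cong refl)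
  then show ?thesis by (auto simp: h_multiples_def mult.assoc)
qed

text \<open>Normality makes the right ideal hR two-sided: writing \<open>r\<close> as
  \<open>diag_hom (inverse q)\<close> of \<open>diag_hom q r\<close> lets h move to the
  left.\<close>

lemma h_multiples_left:
  assumes q: "q \<noteq> 0" and "f \<in> h_multiples q"
  shows "r * f \<in> h_multiples q"
proof -
  obtain u where "nf q f = nf q (h_free q * u)" using assms(2) by (auto simp: h_multiples_def)
  then have "nf q (r * f) = nf q (r * (h_free q * u))" by (intro nf_mult_cong refl)
  also have "\<dots> = nf q (diag_hom (inverse q) (diag_hom q r) * h_free q * u)"
    unfolding mult.assoc[symmetric] using q
    by (intro nf_mult_cong refl) (simp add: nf_diag_hom_diag_hom nf_diag_hom_1)
  also have "\<dots> = nf q (h_free q * diag_hom q r * u)"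
    by (intro nf_mult_cong refl nf_h_normal[symmetric] q)
  finally show ?thesis by (auto simp: h_multiples_def mult.assoc)
qed

text \<open>In other words R/hR is commutative. The generators commute modulo hR since yx - xy is
  h/q, and the product rule for commutators, first in \<open>g\<close> and then in \<open>f\<close>,
  gives the rest.\<close>

lemma commutator_h_multiple:
  fixes f g :: "'k::field free"
  assumes q: "q \<noteq> 0"
  shows "f * g - g * f \<in> h_multiples q"
proof -
  have 0: "0 \<in> h_multiples q" by (auto simp: h_multiples_def intro: exI[of _ 0])
  have "nf q (free_y * free_x - free_x * free_y) = nf q (h_free q * free_const (inverse q))"
    using q by (simp add: free_const_commute fun_eq_iff nf_scale nf_h_commutator flip: mult.assoc)
  then have yx: "free_y * free_x - free_x * free_y \<in> h_multiples q" by (auto simp: h_multiples_def)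
  then have xy: "free_x * free_y - free_y * free_x \<in> h_multiples q"
    using h_multiples_left[OF q yx, of "-1"] by simp
  have x: "free_x * g - g * free_x \<in> h_multiples q" for g
  proof (induction g rule: free_induct)
    case (const c)
    show ?case by (simp add: free_const_commute 0)
  next
    case (x f)
    have "free_x * (free_x * f) - free_x * f * free_x = free_x * (free_x * f - f * free_x)"
      by (simp add: algebra_simps)
    then show ?case by (simp only: h_multiples_left[OF q x])
  next
    case (y f)
    have "free_x * (free_y * f) - free_y * f * free_x
      = free_y * (free_x * f - f * free_x) + (free_x * free_y - free_y * free_x) * f"
      by (simp add: algebra_simps)
    then show ?case
      by (simp only: h_multiples_add[OF h_multiples_left[OF q y] h_multiples_right[OF xy]])
  next
    case (add f g)
    have "free_x * (f + g) - (f + g) * free_x = (free_x * f - f * free_x) + (free_x * g - g * free_x)"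
      by (simp add: algebra_simps)
    then show ?case by (simp only: h_multiples_add[OF add])
  qed
  have y: "free_y * g - g * free_y \<in> h_multiples q" for g
  proof (induction g rule: free_induct)
    case (const c)
    show ?case by (simp add: free_const_commute 0)
  next
    case (y f)
    have "free_y * (free_y * f) - free_y * f * free_y = free_y * (free_y * f - f * free_y)"
      by (simp add: algebra_simps)
    then show ?case by (simp only: h_multiples_left[OF q y])
  next
    case (x f)
    have "free_y * (free_x * f) - free_x * f * free_y
      = free_x * (free_y * f - f * free_y) + (free_y * free_x - free_x * free_y) * f"
      by (simp add: algebra_simps)
    then show ?case
      by (simp only: h_multiples_add[OF h_multiples_left[OF q x] h_multiples_right[OF yx]])
  next
    case (add f g)
    have "free_y * (f + g) - (f + g) * free_y = (free_y * f - f * free_y) + (free_y * g - g * free_y)"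
      by (simp add: algebra_simps)
    then show ?case by (simp only: h_multiples_add[OF add])
  qed
  show ?thesis
  proof (induction f rule: free_induct)
    case (const c)
    show ?case by (simp add: free_const_commute 0)
  next
    case xs: (x f)
    have "free_x * f * g - g * (free_x * f) = free_x * (f * g - g * f) + (free_x * g - g * free_x) * f"
      by (simp add: algebra_simps)
    then show ?case
      by (simp only: h_multiples_add[OF h_multiples_left[OF q xs] h_multiples_right[OF x]])
  next
    case ys: (y f)
    have "free_y * f * g - g * (free_y * f) = free_y * (f * g - g * f) + (free_y * g - g * free_y) * f"
      by (simp add: algebra_simps)
    then show ?case
      by (simp only: h_multiples_add[OF h_multiples_left[OF q ys] h_multiples_right[OF y]])
  next
    case (add f1 f2)
    have "(f1 + f2) * g - g * (f1 + f2) = (f1 * g - g * f1) + (f2 * g - g * f2)"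
      by (simp add: algebra_simps)
    then show ?case by (simp only: h_multiples_add[OF add])
  qed
qed

section \<open>The automorphism group\<close>

text \<open>A mere choice of representatives: \<open>F\<close> respects sums and products only
  modulo the ideal.\<close>

lemma Aut_lift:
  assumes "f \<in> Aut q"
  shows "\<exists>F. \<forall>a. f (qcls q a) = qcls q (F a)"
proof (intro choice allI)
  fix a show "\<exists>b. f (qcls q a) = qcls q b"
    using Aut_closed[OF assms qcls_carrier[of q a]] by (rule qcls_cases) blast
qed

lemma powi_eq_1_imp_0:
  fixes q :: "'k::field"
  assumes q: "q \<noteq> 0" "\<And>n::nat. n > 0 \<Longrightarrow> q ^ n \<noteq> 1" and "q powi m = 1"
  shows "m = 0"
proof (rule ccontr)
  assume m: "m \<noteq> 0"
  have "q powi (if m \<ge> 0 then m else - m) = 1"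
    using assms(3) q(1) by (simp add: power_int_minus)
  then have "q ^ nat \<bar>m\<bar> = 1"
    by (simp add: power_int_def abs_if split: if_splits)
  then show False using q(2)[of "nat \<bar>m\<bar>"] m by simp
qed

lemma Aut_is_rho:
  assumes q: "q \<noteq> 0" "\<And>n::nat. n > 0 \<Longrightarrow> q ^ n \<noteq> 1" and f: "f \<in> Aut q"
  obtains \<beta> where "\<beta> \<noteq> 0" "f = rho q \<beta>"
proof -
  let ?H = "h_free q"
  obtain F where F: "\<And>a. f (qcls q a) = qcls q (F a)" using Aut_lift[OF f] by blast
  have add: "nf q (F (a + b)) = nf q (F a + F b)"
    and mult: "nf q (F (a * b)) = nf q (F a * F b)"
    and scale: "nf q (F (free_const c * a)) = nf q (free_const c * F a)"
    and one: "nf q (F 1) = nf q 1" for a b c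
    using Aut_simps[OF f, unfolded F] by (simp_all add: qcls_eq_iff)
  have cong: "nf q (F a) = nf q (F b)" if "nf q a = nf q b" for a b
    using that F by (metis qcls_eq_iff)
  have diff: "nf q (F (a - b)) = nf q (F a - F b)" for a b
    using add[of "a - b" b] by (simp add: fun_eq_iff nf_add nf_diff)
  have comm: "nf q (F (free_const c * (a * b - b * a))) = nf q (free_const c * (F a * F b - F b * F a))"
    for c a b
    unfolding scale by (simp add: fun_eq_iff nf_scale diff mult nf_diff)
  have surj: "\<exists>s. nf q (F s) = nf q a" for a
  proof -
    have "qcls q a \<in> f ` carrier (qweyl q)"
      using f by (auto simp: Aut_def Bij_def bij_betw_def)
    then show ?thesis by (auto simp: carrier_qweyl F qcls_eq_iff)
  qed
  \<comment> \<open>Preimages of y and x; they do the work of the inverse automorphism.\<close>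
  obtain s t where s: "nf q (F s) = nf q free_y" and t: "nf q (F t) = nf q free_x"
    using surj by metis
  define fx where "fx = F free_x"
  define fy where "fy = F free_y"
  obtain U where U: "nf q (fy * fx - fx * fy) = nf q (?H * U)"
    using commutator_h_multiple[OF q(1), of fy fx] by (auto simp: h_multiples_def)
  obtain V where V: "nf q (s * t - t * s) = nf q (?H * V)"
    using commutator_h_multiple[OF q(1), of s t] by (auto simp: h_multiples_def)
  \<comment> \<open>The image of h is q times the commutator of the images of y and x, hence lies in
    hR.\<close>
  have FH: "nf q (F ?H) = nf q (free_const q * (?H * U))"
  proof -
    have "nf q (F ?H) = nf q (F (free_const q * (free_y * free_x - free_x * free_y)))"
      by (rule cong) (rule nf_h_commutator)
    also have "\<dots> = nf q (free_const q * (fy * fx - fx * fy))" by (simp only: comm fx_def fy_def)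
    also have "\<dots> = nf q (free_const q * (?H * U))" by (simp add: fun_eq_iff nf_scale U)
    finally show ?thesis .
  qed
  \<comment> \<open>Conversely h is the image of q(st - ts), an element of hR. Together with
    \<open>FH\<close> this reads h = h U (q^2 F V), and cancelling h makes \<open>U\<close> a unit,
    that is, a scalar.\<close>
  have "nf q ?H = nf q (free_const q * (F s * F t - F t * F s))"
    using nf_mult_cong[OF s t] nf_mult_cong[OF t s]
    by (simp add: nf_h_commutator fun_eq_iff nf_scale nf_diff)
  also have "\<dots> = nf q (F (free_const q * (s * t - t * s)))" by (rule comm[symmetric])
  also have "\<dots> = nf q (F (free_const q * (?H * V)))"
    by (rule cong) (simp add: fun_eq_iff nf_scale V)
  also have "\<dots> = nf q (free_const q * (F ?H * F V))"
    unfolding scale by (simp add: fun_eq_iff nf_scale mult)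
  also have "\<dots> = nf q (free_const q * ((free_const q * (?H * U)) * F V))"
    by (intro nf_mult_cong refl FH)
  also have "free_const q * ((free_const q * (?H * U)) * F V) = ?H * (U * (free_const (q * q) * F V))"
    by (simp add: free_const_mult mult.assoc free_const_left_commute[of ?H] free_const_left_commute[of U])
  finally have "nf q (?H * (U * (free_const (q * q) * F V) - 1)) = (\<lambda>_. 0)"
    by (simp add: right_diff_distrib fun_eq_iff nf_diff)
  moreover have H0: "nf q ?H \<noteq> (\<lambda>_. 0)"
    using q(1) by (auto simp: fun_eq_iff nf_h_free intro!: exI[of _ 0])
  ultimately have "nf q (U * (free_const (q * q) * F V) - 1) = (\<lambda>_. 0)"
    using nf_mult_eq_0 q(1) by blast
  then have "nf q (U * (free_const (q * q) * F V)) = nf q 1"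
    by (simp add: fun_eq_iff nf_diff)
  then obtain c where c: "c \<noteq> 0" "nf q U = nf q (free_const c)"
    using nf_unit_const[OF q(1)] by blast
  define l where "l = q * c"
  have l: "l \<noteq> 0" using q c by (simp add: l_def)
  have Fl: "nf q (F ?H) = nf q (free_const l * ?H)"
  proof -
    have "nf q (free_const q * (?H * U)) = nf q (free_const q * (?H * free_const c))"
      by (intro nf_mult_cong refl c)
    then show ?thesis by (simp add: FH l_def free_const_mult free_const_commute[of ?H] mult.assoc)
  qed

  \<comment> \<open>Suppose hz = czh for a scalar \<open>c\<close>. Applying the automorphism and
    cancelling \<open>l\<close> gives the same equation for \<open>F z\<close>; by normality and
    cancellation of h, \<open>diag_hom (inverse q)\<close> multiplies \<open>F z\<close> by
    \<open>c\<close>, which fixes the weights of its monomials.\<close>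
  have wt: "inverse q powi (int j - int i) = c"
    if z: "nf q (?H * z) = nf q (free_const c * (z * ?H))" and nz: "nf q (F z) (i, j) \<noteq> 0" for z c i j
  proof -
    have "nf q ((free_const l * ?H) * F z) = nf q (F (?H * z))"
      unfolding mult by (intro nf_mult_cong refl Fl[symmetric])
    also have "\<dots> = nf q (F (free_const c * (z * ?H)))"
      by (rule cong) (rule z)
    also have "\<dots> = nf q (free_const c * (F z * (free_const l * ?H)))"
      using nf_mult_cong[OF refl[of "nf q (F z)"] Fl]
      unfolding scale by (simp add: fun_eq_iff nf_scale mult)
    finally have "nf q (?H * F z) = nf q (free_const c * F z * ?H)"
      using l by (simp add: mult.assoc free_const_left_commute[of "F z"] fun_eq_iff nf_scale)
    then have "nf q ((diag_hom (inverse q) (F z) - free_const c * F z) * ?H) = (\<lambda>_. 0)"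
      by (simp add: left_diff_distrib fun_eq_iff nf_diff flip: nf_h_normal[OF q(1)])
    then have "nf q (diag_hom (inverse q) (F z) - free_const c * F z) = (\<lambda>_. 0)"
      using nf_mult_eq_0[OF q(1)] H0 by blast
    then have "inverse q powi (int j - int i) * nf q (F z) (i, j) = c * nf q (F z) (i, j)"
      using q(1) by (simp add: fun_eq_iff nf_diff nf_diag_hom nf_scale)
    then show ?thesis using nz by simp
  qed
  have inv_powi: "inverse q powi (int j - int i) = q powi (int i - int j)" for i j
    by (metis minus_diff_eq power_int_inverse power_int_minus)
  have fx_wt: "int i - int j = 1" if "nf q fx (i, j) \<noteq> 0" for i j
  proof -
    have "inverse q powi (int j - int i) = q"
      using that nf_h_x[of q] unfolding fx_def by (intro wt[of free_x]) (simp_all add: mult.assoc)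
    moreover have "q powi (int i - int j - 1) = inverse q powi (int j - int i) * inverse q"
      using power_int_add[of q "int i - int j" "-1"] q(1) by (simp add: inv_powi)
    ultimately have "q powi (int i - int j - 1) = 1" using q(1) by simp
    then show ?thesis using powi_eq_1_imp_0[OF q] by force
  qed
  have fy_wt: "int j - int i = 1" if "nf q fy (i, j) \<noteq> 0" for i j
  proof -
    have "inverse q powi (int j - int i) = inverse q"
      using that nf_h_y[OF q(1)] unfolding fy_def by (intro wt[of free_y]) (simp_all add: mult.assoc)
    moreover have "q powi (int i - int j + 1) = inverse q powi (int j - int i) * q"
      using power_int_add[of q "int i - int j" 1] q(1) by (simp add: inv_powi)
    ultimately have "q powi (int i - int j + 1) = 1" using q(1) by simp
    then show ?thesis using powi_eq_1_imp_0[OF q] by force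
  qed
  have q1: "q \<noteq> 1" using q(2)[of 1] by simp
  have "nf q (F ?H) = nf q (1 - free_const (1 - q) * (fy * fx))"
    unfolding h_free_def fx_def fy_def by (simp add: fun_eq_iff diff nf_diff scale nf_scale mult[of free_y] one)
  \<comment> \<open>The image of h = 1 - (1 - q)yx is also l h, so the product
    \<open>fy * fx\<close> is known up to the factor 1 - q and has leading monomial xy.\<close>
  then have YX: "(1 - q) * nf q (fy * fx) p = nf q 1 p - l * nf q ?H p" for p
    by (cases p) (simp add: Fl fun_eq_iff nf_diff nf_scale)
  have "nf q (fy * fx) p = 0" if "\<not> lex_le p (1, 1)" for p
    using YX[of p] q1 that by (cases p) (auto simp: nf_1 nf_h_free lex_le_def split: if_splits)
  then have "lead_bound q (1, 1) (fy * fx)" unfolding lead_bound_def by blast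
  moreover have YX11: "nf q (fy * fx) (1, 1) \<noteq> 0"
    using YX[of "(1, 1)"] q1 l q(1) by (auto simp: nf_1 nf_h_free)
  ultimately have leadYX: "s = (1, 1)" if "lead_bound q s (fy * fx)" "nf q (fy * fx) s \<noteq> 0" for s
    using lead_unique that by blast
  have "nf q fx \<noteq> nf q 0" "nf q fy \<noteq> nf q 0"
    using nf_mult_cong[of q fx 0 fy fy] nf_mult_cong[of q fy fy fx 0] nf_mult_cong[of q fy 0 fx fx] YX11 by auto
  then have ne: "nf q fx \<noteq> (\<lambda>_. 0)" "nf q fy \<noteq> (\<lambda>_. 0)" by (auto simp: fun_eq_iff)
  obtain i j where fx: "lead_bound q (i, j) fx" "nf q fx (i, j) \<noteq> 0" using ne(1) by (rule lead_exists)
  obtain a b where fy: "lead_bound q (a, b) fy" "nf q fy (a, b) \<noteq> 0" using ne(2) by (rule lead_exists)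
  have "(i + a, j + b) = (1, 1)"
    by (rule leadYX) (use lead_mult[OF fy(1) fx(1)] fx(2) fy(2) q(1) in simp_all)
  with fx_wt[OF fx(2)] fy_wt[OF fy(2)] have ij: "i = 1" "j = 0" "a = 0" "b = 1" by auto
  define \<xi> where "\<xi> = nf q fx (1, 0)"
  define \<beta> where "\<beta> = nf q fy (0, 1)"
  \<comment> \<open>The other monomials of weight -1 are x^(m+1) y^m with m positive, all above the
    leading exponent (1, 0).\<close>
  have "nf q fx (k, m) = 0" if "(k, m) \<noteq> (1, 0)" for k m
    using fx_wt[of k m] fx(1) that unfolding ij lead_bound_def lex_le_def by fastforce
  then have fx': "nf q fx = nf q (free_const \<xi> * free_x)"
    by (auto simp: fun_eq_iff nf_scale nf_x \<xi>_def)
  have "nf q fy (k, m) = 0" if "(k, m) \<noteq> (0, 1)" for k m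
    using fy_wt[of k m] fy(1) that unfolding ij lead_bound_def lex_le_def by fastforce
  then have fy': "nf q fy = nf q (free_const \<beta> * free_y)"
    by (auto simp: fun_eq_iff nf_scale nf_y \<beta>_def)
  \<comment> \<open>The constant coefficient of the transported relation makes the two scalars
    inverse to each other.\<close>
  have "nf q (fy * fx) = nf q (F (free_const q * (free_x * free_y) + 1))"
    unfolding mult[symmetric] fx_def fy_def by (rule cong) (use nf_rel[of q] in \<open>simp add: mult.assoc\<close>)
  also have "\<dots> = nf q (free_const q * (fx * fy) + 1)"
    by (simp add: fun_eq_iff add nf_add scale nf_scale mult[of free_x] one fx_def fy_def)
  finally have "nf q (fy * fx) (0, 0) = q * nf q (fx * fy) (0, 0) + 1"
    by (simp add: nf_add nf_scale nf_1)
  then have "\<beta> * \<xi> = 1"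
    using nf_mult_cong[OF fx' fy'] nf_mult_cong[OF fy' fx']
    by (simp add: free_const_left_commute[of free_x] free_const_left_commute[of free_y]
        mult.assoc nf_scale nf_yx nf_xy)
  then have \<beta>: "\<beta> \<noteq> 0" "\<xi> = inverse \<beta>"
    using inverse_unique[of \<beta> \<xi>] by auto
  have "f = rho q \<beta>"
  proof (rule Aut_eqI[OF f rho_Aut[OF \<beta>(1)]])
    show "f (Rx q) = rho q \<beta> (Rx q)"
      using fx' \<beta> by (simp add: Rx_def F rho_qcls qcls_eq_iff fx_def)
    show "f (Ry q) = rho q \<beta> (Ry q)"
      using fy' \<beta> by (simp add: Ry_def F rho_qcls qcls_eq_iff fy_def)
  qed
  with \<beta>(1) show ?thesis by (rule that)
qed

section \<open>Isotropy of skew derivations\<close>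

lemma Der_values_on_gens:
  "d \<in> Der q \<mu> \<Longrightarrow> \<mu> \<noteq> 0 \<Longrightarrow> \<exists>u v. d (Rx q) = qcls q u \<and> d (Ry q) = qcls q v"
  using Der_simps(1)[of \<mu> d q free_x] Der_simps(1)[of \<mu> d q free_y]
  by (auto simp: carrier_qweyl Rx_def Ry_def)

text \<open>Both sides obey the same twisted Leibniz rule. Isotropy can therefore be computed on
  representatives in the free algebra.\<close>

lemma Der_as_free_der:
  assumes \<mu>: "\<mu> \<noteq> 0" and d: "d \<in> Der q \<mu>" and uv: "d (Rx q) = qcls q u" "d (Ry q) = qcls q v"
  shows "d (qcls q f) = qcls q (free_der \<mu> u v f)"
proof (induction f rule: free_induct)
  case (const c)
  show ?case by (simp add: Der_const[OF \<mu> d])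
next
  case (x f)
  then show ?case using uv by (simp add: Der_simps(4)[OF \<mu> d] free_der_x_mult Rx_def)
next
  case (y f)
  then show ?case using uv by (simp add: Der_simps(4)[OF \<mu> d] free_der_y_mult Ry_def)
next
  case (add f g)
  then show ?case by (simp add: Der_simps(2)[OF \<mu> d] free_der_add)
qed

lemma rho_in_isotropy_iff:
  assumes "\<beta> \<noteq> 0" "\<And>f. d (qcls q f) \<in> carrier (qweyl q)"
  shows "rho q \<beta> \<in> isotropy q d \<longleftrightarrow> (\<forall>f. rho q \<beta> (d (qcls q f)) = d (qcls q (diag_hom \<beta> f)))"
  using assms
  by (auto simp: isotropy_def rho_Aut compose_def fun_eq_iff carrier_qweyl rho_qcls restrict_def)

text \<open>Diagonal maps commute with the twist, so both sides satisfy the same Leibniz recursion,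
  and the hypotheses settle the generators.\<close>

lemma nf_diag_hom_free_der:
  assumes u: "nf q (diag_hom \<beta> u) = nf q (free_const (inverse \<beta>) * u)"
    and v: "nf q (diag_hom \<beta> v) = nf q (free_const \<beta> * v)"
  shows "nf q (diag_hom \<beta> (free_der \<mu> u v f)) = nf q (free_der \<mu> u v (diag_hom \<beta> f))"
proof (induction f rule: free_induct)
  case (const c)
  show ?case by simp
next
  case (x f)
  have "nf q (diag_hom \<beta> (free_der \<mu> u v (free_x * f)))
    = nf q (diag_hom \<beta> u * diag_hom \<beta> f
        + diag_hom \<beta> (diag_hom \<mu> free_x) * diag_hom \<beta> (free_der \<mu> u v f))"
    by (simp add: free_der_x_mult)
  also have "\<dots> = nf q (free_const (inverse \<beta>) * u * diag_hom \<beta> f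
      + diag_hom \<beta> (diag_hom \<mu> free_x) * free_der \<mu> u v (diag_hom \<beta> f))"
    using nf_mult_cong[OF u refl, of "diag_hom \<beta> f"] nf_mult_cong[OF refl x, of "diag_hom \<beta> (diag_hom \<mu> free_x)"]
    by (simp add: fun_eq_iff nf_add)
  also have "\<dots> = nf q (free_der \<mu> u v (diag_hom \<beta> (free_x * f)))"
    by (simp add: free_der_x_mult free_der_scale mult.assoc distrib_left
        free_const_left_commute[of "free_const (inverse \<mu>)" "inverse \<beta>"])
  finally show ?case .
next
  case (y f)
  have "nf q (diag_hom \<beta> (free_der \<mu> u v (free_y * f)))
    = nf q (diag_hom \<beta> v * diag_hom \<beta> f
        + diag_hom \<beta> (diag_hom \<mu> free_y) * diag_hom \<beta> (free_der \<mu> u v f))"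
    by (simp add: free_der_y_mult)
  also have "\<dots> = nf q (free_const \<beta> * v * diag_hom \<beta> f
      + diag_hom \<beta> (diag_hom \<mu> free_y) * free_der \<mu> u v (diag_hom \<beta> f))"
    using nf_mult_cong[OF v refl, of "diag_hom \<beta> f"] nf_mult_cong[OF refl y, of "diag_hom \<beta> (diag_hom \<mu> free_y)"]
    by (simp add: fun_eq_iff nf_add)
  also have "\<dots> = nf q (free_der \<mu> u v (diag_hom \<beta> (free_y * f)))"
    by (simp add: free_der_y_mult free_der_scale mult.assoc distrib_left
        free_const_left_commute[of "free_const \<mu>" "\<beta>"])
  finally show ?case .
next
  case (add f g)
  then show ?case by (simp add: free_der_add fun_eq_iff nf_add)
qed

text \<open>Evaluation at x and y gives one direction, the Leibniz recursion the other. The isotropy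
  of all three summands and of their sum is read off from this criterion.\<close>

lemma rho_in_isotropy_Der_iff:
  assumes \<mu>: "\<mu> \<noteq> 0" and \<beta>: "\<beta> \<noteq> 0" and d: "d \<in> Der q \<mu>"
    and uv: "d (Rx q) = qcls q u" "d (Ry q) = qcls q v"
  shows "rho q \<beta> \<in> isotropy q d \<longleftrightarrow>
    nf q (diag_hom \<beta> u) = nf q (free_const (inverse \<beta>) * u)
    \<and> nf q (diag_hom \<beta> v) = nf q (free_const \<beta> * v)"
proof -
  have val: "d (qcls q f) = qcls q (free_der \<mu> u v f)" for f
    by (rule Der_as_free_der[OF \<mu> d uv])
  have "rho q \<beta> \<in> isotropy q d \<longleftrightarrow>
      (\<forall>f. nf q (diag_hom \<beta> (free_der \<mu> u v f)) = nf q (free_der \<mu> u v (diag_hom \<beta> f)))"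
    using \<beta> by (subst rho_in_isotropy_iff) (simp_all add: val rho_qcls qcls_eq_iff)
  also have "\<dots> \<longleftrightarrow> nf q (diag_hom \<beta> u) = nf q (free_const (inverse \<beta>) * u)
    \<and> nf q (diag_hom \<beta> v) = nf q (free_const \<beta> * v)" (is "?A \<longleftrightarrow> ?B")
  proof
    assume A: ?A
    from A[rule_format, of free_x] A[rule_format, of free_y] show ?B
      by (simp add: free_der_scale)
  qed (auto intro: nf_diag_hom_free_der)
  finally show ?thesis .
qed

lemma zero_map_qcls [simp]: "zero_map q (qcls q f) = qcls q 0"
  by (simp add: zero_map_def)

lemma zero_map_Der: "\<mu> \<noteq> 0 \<Longrightarrow> zero_map q \<in> Der q \<mu>"
  by (rule DerI) (simp_all add: zero_map_def)

lemma isotropy_subset_Aut: "isotropy q d \<subseteq> Aut q"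
  by (auto simp: isotropy_def)

lemma isotropy_eq_Aut:
  assumes "q \<noteq> 0" "\<And>n::nat. n > 0 \<Longrightarrow> q ^ n \<noteq> 1" "\<And>\<beta>. \<beta> \<noteq> 0 \<Longrightarrow> rho q \<beta> \<in> isotropy q d"
  shows "isotropy q d = Aut q"
  using assms isotropy_subset_Aut[of q d] by (auto elim: Aut_is_rho)

lemma rho_in_isotropy_zero_map: "\<beta> \<noteq> 0 \<Longrightarrow> rho q \<beta> \<in> isotropy q (zero_map q)"
  by (simp add: rho_in_isotropy_iff rho_qcls)

section \<open>Inner derivations\<close>

lemma Inner_qcls:
  "\<mu> \<noteq> 0 \<Longrightarrow> Inner q \<mu> (qcls q w) (qcls q a) = qcls q (w * a - diag_hom \<mu> a * w)"
  by (simp add: Inner_def rho_qcls)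

lemma Inner_Der:
  assumes "\<mu> \<noteq> 0"
  shows "Inner q \<mu> (qcls q w) \<in> Der q \<mu>"
proof (rule DerI)
  show "Inner q \<mu> (qcls q w) \<in> extensional (carrier (qweyl q))" by (simp add: Inner_def)
qed (use assms in \<open>simp_all add: Inner_qcls algebra_simps free_const_left_commute[of w]\<close>)

lemma Inner_x: "\<mu> \<noteq> 0 \<Longrightarrow> Inner q \<mu> (qcls q w) (Rx q)
    = qcls q (w * free_x - free_const (inverse \<mu>) * (free_x * w))"
  and Inner_y: "\<mu> \<noteq> 0 \<Longrightarrow> Inner q \<mu> (qcls q w) (Ry q)
    = qcls q (w * free_y - free_const \<mu> * (free_y * w))"
  by (simp_all add: Rx_def Ry_def Inner_qcls mult.assoc)

section \<open>Skew commutators with the generators\<close>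

lemma nf_eq_iff_diff: "nf q f = nf q g \<longleftrightarrow> nf q (f - g) = (\<lambda>_. 0)"
  by (auto simp: fun_eq_iff nf_diff)

lemma skew_commutator_diff:
  "(v * g - free_const c * (g * v)) - (w * g - free_const c * (g * w))
    = (v - w) * g - free_const c * (g * (v - w))"
  by (simp add: algebra_simps)

lemma nf_skew_commutator_x:
  "nf q (v * free_x - free_const c * (free_x * v)) (0, j) = qnum q (Suc j) * nf q v (0, Suc j)"
  "nf q (v * free_x - free_const c * (free_x * v)) (Suc i, j)
     = (q ^ j - c) * nf q v (i, j) + qnum q (Suc j) * nf q v (Suc i, Suc j)"
  by (simp_all add: nf_diff nf_scale nf_right_x nf_left_x right_x_def left_x_def algebra_simps)

lemma nf_skew_commutator_y:
  "nf q (v * free_y - free_const c * (free_y * v)) (i, 0) = - c * qnum q (Suc i) * nf q v (Suc i, 0)"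
  "nf q (v * free_y - free_const c * (free_y * v)) (i, Suc j)
     = (1 - c * q ^ i) * nf q v (i, j) - c * qnum q (Suc i) * nf q v (Suc i, Suc j)"
  by (simp_all add: nf_diff nf_scale nf_right_y nf_left_y right_y_def left_y_def algebra_simps)

text \<open>For i < j the equation for x kills the coefficient at (0, m + 1) and then propagates
  along the diagonal, since q-integers of positive index are nonzero; for i > j the equation for y
  does the same from (m + 1, 0). The diagonal i = j has no such starting point.\<close>

lemma skew_central_weight_0:
  assumes q: "\<And>n::nat. n > 0 \<Longrightarrow> q ^ n \<noteq> 1" and \<mu>: "\<mu> \<noteq> 0"
    and x: "nf q (v * free_x - free_const (inverse \<mu>) * (free_x * v)) = (\<lambda>_. 0)"
    and y: "nf q (v * free_y - free_const \<mu> * (free_y * v)) = (\<lambda>_. 0)"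
    and ij: "i \<noteq> j"
  shows "nf q v (i, j) = 0"
proof -
  have qn: "qnum q (Suc n) \<noteq> 0" for n
    using qnum_eq_0_iff[OF q, of "Suc n"] by simp
  have pos: "nf q v (i, i + Suc m) = 0" for i m
  proof (induction i)
    case 0
    show ?case using nf_skew_commutator_x(1)[of q v "inverse \<mu>" m] qn x by simp
  next
    case (Suc i)
    show ?case using nf_skew_commutator_x(2)[of q v "inverse \<mu>" i "i + Suc m"] qn x Suc by simp
  qed
  have neg: "nf q v (j + Suc m, j) = 0" for j m
  proof (induction j)
    case 0
    show ?case using nf_skew_commutator_y(1)[of q v \<mu> m] qn y \<mu> by simp
  next
    case (Suc j)
    show ?case using nf_skew_commutator_y(2)[of q v \<mu> "j + Suc m" j] qn y Suc \<mu> by simp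
  qed
  show ?thesis
  proof (cases "i < j")
    case True
    then obtain m where "j = i + Suc m" using less_imp_Suc_add by auto
    then show ?thesis using pos by simp
  next
    case False
    then obtain m where "i = j + Suc m" using ij less_imp_Suc_add[of j i] by auto
    then show ?thesis using neg by simp
  qed
qed

text \<open>For \<open>\<mu> = q\<close> the inner derivations meet \<open>\<P>\<^sub>\<mu>\<close> trivially: along each diagonal a coefficient of \<open>v\<close> is
  determined by the next one, and the coefficients vanish far out.\<close>

lemma skew_commutator_x_eq_0:
  assumes q: "q \<noteq> 0" "\<And>n::nat. n > 0 \<Longrightarrow> q ^ n \<noteq> 1"
    and x: "\<And>i j. nf q (v * free_x - free_const (inverse q) * (free_x * v)) (Suc i, j) = 0"
  shows "nf q v = (\<lambda>_. 0)"
proof -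
  have "finite (fst ` {p. nf q v p \<noteq> 0})" using finite_nf by blast
  then obtain N where N: "\<And>k. k \<in> fst ` {p. nf q v p \<noteq> 0} \<Longrightarrow> k < N"
    unfolding finite_nat_set_iff_bounded by blast
  have step: "nf q v (i, j) = 0" if "nf q v (Suc i, Suc j) = 0" for i j
  proof -
    have "q ^ j \<noteq> inverse q" using q(1) q(2)[of "Suc j"] by (auto simp: field_simps)
    then show ?thesis using nf_skew_commutator_x(2)[of q v "inverse q" i j] x that by simp
  qed
  have down: "nf q v (i, j) = 0" if "nf q v (i + k, j + k) = 0" for i j k
    using that by (induction k) (auto dest: step)
  have "nf q v (i, j) = 0" for i j
  proof (rule down)
    show "nf q v (i + N, j + N) = 0" using N[of "i + N"] by force
  qed
  then show ?thesis by auto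
qed

text \<open>Conjugating the inner derivation of \<open>w\<close> by \<open>rho q \<beta>\<close>
  gives the inner derivation of the image of \<open>w\<close>; this is that identity at x, with c
  the inverse of \<mu>.\<close>

lemma diag_hom_skew_commutator_x:
  assumes \<beta>: "\<beta> \<noteq> 0"
  shows "free_const \<beta> * diag_hom \<beta> (w * free_x - free_const c * (free_x * w))
    = diag_hom \<beta> w * free_x - free_const c * (free_x * diag_hom \<beta> w)"
proof -
  have *: "free_const \<beta> * (free_const (inverse \<beta>) * f) = f" for f
    using \<beta> by (simp flip: mult.assoc free_const_mult)
  show ?thesis
    by (simp add: right_diff_distrib mult.assoc free_const_left_commute[of "diag_hom \<beta> w"]
        free_const_left_commute[of "free_const c" "inverse \<beta>"] *)
qed

lemma diag_hom_skew_commutator_y: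
  assumes \<beta>: "\<beta> \<noteq> 0"
  shows "free_const (inverse \<beta>) * diag_hom \<beta> (w * free_y - free_const c * (free_y * w))
    = diag_hom \<beta> w * free_y - free_const c * (free_y * diag_hom \<beta> w)"
proof -
  have *: "free_const (inverse \<beta>) * (free_const \<beta> * f) = f" for f
    using \<beta> by (simp flip: mult.assoc free_const_mult)
  show ?thesis
    by (simp add: right_diff_distrib mult.assoc free_const_left_commute[of "diag_hom \<beta> w"]
        free_const_left_commute[of "free_const c" "\<beta>"] *)
qed

lemma nf_scale_inverse_iff:
  assumes "\<beta> \<noteq> 0"
  shows "nf q f = nf q (free_const (inverse \<beta>) * g) \<longleftrightarrow> nf q (free_const \<beta> * f) = nf q g"
    and "nf q f = nf q (free_const \<beta> * g) \<longleftrightarrow> nf q (free_const (inverse \<beta>) * f) = nf q g"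
  using assms by (auto simp: fun_eq_iff nf_scale field_simps)

text \<open>Commuting means that \<open>w\<close> and its image induce the same inner derivation, so
  their difference \<open>?v\<close> induces zero. The coefficients of \<open>?v\<close> are those
  of \<open>w\<close> times \<beta>^(j-i) - 1: they vanish for i = j, and
  \<open>skew_central_weight_0\<close> kills the others.\<close>

lemma rho_in_isotropy_Inner_iff:
  assumes q: "\<And>n::nat. n > 0 \<Longrightarrow> q ^ n \<noteq> 1" and \<mu>: "\<mu> \<noteq> 0" and \<beta>: "\<beta> \<noteq> 0"
  shows "rho q \<beta> \<in> isotropy q (Inner q \<mu> (qcls q w)) \<longleftrightarrow>
    (\<forall>i j. nf q w (i, j) \<noteq> 0 \<longrightarrow> \<beta> powi (int j - int i) = 1)" (is "?L \<longleftrightarrow> ?R")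
proof -
  let ?w = "diag_hom \<beta> w"
  let ?v = "?w - w"
  have "?L \<longleftrightarrow> nf q (?w * free_x - free_const (inverse \<mu>) * (free_x * ?w))
        = nf q (w * free_x - free_const (inverse \<mu>) * (free_x * w))
      \<and> nf q (?w * free_y - free_const \<mu> * (free_y * ?w)) = nf q (w * free_y - free_const \<mu> * (free_y * w))"
    unfolding rho_in_isotropy_Der_iff[OF \<mu> \<beta> Inner_Der[OF \<mu>] Inner_x[OF \<mu>] Inner_y[OF \<mu>]]
      nf_scale_inverse_iff[OF \<beta>] diag_hom_skew_commutator_x[OF \<beta>] diag_hom_skew_commutator_y[OF \<beta>] ..
  also have "\<dots> \<longleftrightarrow> nf q (?v * free_x - free_const (inverse \<mu>) * (free_x * ?v)) = (\<lambda>_. 0)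
      \<and> nf q (?v * free_y - free_const \<mu> * (free_y * ?v)) = (\<lambda>_. 0)"
    unfolding nf_eq_iff_diff[of q "_ - _"] skew_commutator_diff ..
  also have "\<dots> \<longleftrightarrow> ?R" (is "?A \<longleftrightarrow> _")
  proof
    assume ?A
    then have *: "nf q ?v (i, j) = 0" if "i \<noteq> j" for i j
      using skew_central_weight_0[OF q \<mu> _ _ that] by blast
    show ?R
    proof (intro allI impI)
      fix i j assume "nf q w (i, j) \<noteq> 0"
      then show "\<beta> powi (int j - int i) = 1"
        using *[of i j] \<beta> by (cases "i = j") (auto simp: nf_diff nf_diag_hom)
    qed
  next
    assume ?R
    then have "nf q ?v (i, j) = 0" for i j
      using \<beta> by (auto simp: nf_diff nf_diag_hom)
    then have "nf q ?v = nf q 0" by auto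
    then have "nf q (?v * free_x) = nf q (0 * free_x)" "nf q (free_x * ?v) = nf q (free_x * 0)"
      "nf q (?v * free_y) = nf q (0 * free_y)" "nf q (free_y * ?v) = nf q (free_y * 0)"
      by (intro nf_mult_cong refl; assumption)+
    then show ?A by (simp add: fun_eq_iff nf_diff nf_scale)
  qed
  finally show ?thesis .
qed

section \<open>The summands \<open>\<H>\<^sub>\<mu>\<close> and \<open>\<P>\<^sub>\<mu>\<close>\<close>

lemma free_const_mult_power: "(free_const c * f) ^ n = free_const (c ^ n) * (f ^ n :: 'k::field free)"
proof (induction n)
  case (Suc n)
  then show ?case
    by (simp add: mult.assoc free_const_left_commute[of f] free_const_mult)
qed simp

text \<open>For \<mu> = q^(-r) the scalars in the value at y cancel, leaving -h^r y. Normality of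
  h^r then makes each side of the compatibility equation vanish separately.\<close>

lemma H_der_values:
  fixes q \<mu> :: "'k::field"
  assumes q: "q \<noteq> 0" and \<mu>: "\<mu> = q powi (- int r)"
  defines "u \<equiv> h_free q ^ r * free_x" and "v \<equiv> - (h_free q ^ r * free_y)"
  shows "H_der q \<mu> r \<in> Der q \<mu>" "H_der q \<mu> r (Rx q) = qcls q u" "H_der q \<mu> r (Ry q) = qcls q v"
proof -
  have \<mu>': "\<mu> = inverse q ^ r" using \<mu> by (simp add: power_int_minus power_inverse)
  have \<mu>0: "\<mu> \<noteq> 0" using q \<mu>' by simp
  have "- (free_const (inverse \<mu>) * ((free_const (inverse q) * h_free q) ^ r * free_y)) = v"
    using q by (simp add: v_def free_const_mult_power \<mu>' power_inverse flip: mult.assoc free_const_mult)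
  then have H: "H_der q \<mu> r = der_on_gens q \<mu> (qcls q u) (qcls q v)"
    by (simp add: H_der_def h_elt_qcls Rx_def Ry_def u_def)
  have hx: "nf q (h_free q ^ r * free_x) = nf q (free_const (inverse \<mu>) * free_x * h_free q ^ r)"
    and hy: "nf q (h_free q ^ r * free_y) = nf q (free_const \<mu> * free_y * h_free q ^ r)"
    using nf_h_power_normal[OF q, of r free_x] nf_h_power_normal[OF q, of r free_y] \<mu>' by simp_all
  have "nf q (v * free_x + free_const \<mu> * (free_y * u)) = nf q 0"
    using nf_mult_cong[OF hy refl, of free_x]
    by (simp add: u_def v_def fun_eq_iff nf_diff mult.assoc)
  moreover have "nf q (free_const q * (u * free_y + free_const (inverse \<mu>) * (free_x * v))) = nf q 0"
    using nf_mult_cong[OF hx refl, of free_y]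
    by (simp add: u_def v_def fun_eq_iff nf_diff nf_scale mult.assoc)
  ultimately have "der_compat q \<mu> u v" by (simp add: der_compat_def)
  then show "H_der q \<mu> r \<in> Der q \<mu>" "H_der q \<mu> r (Rx q) = qcls q u" "H_der q \<mu> r (Ry q) = qcls q v"
    unfolding H using der_on_gens_Der[OF \<mu>0] by blast+
qed

lemma nf_diag_hom_h_power:
  assumes "\<beta> \<noteq> 0"
  shows "nf q (diag_hom \<beta> (h_free q ^ n)) = nf q (h_free q ^ n)"
proof (induction n)
  case (Suc n)
  then show ?case using nf_mult_cong[OF nf_diag_hom_h[OF assms, of q] Suc] by simp
qed simp

lemma H_space_cases:
  assumes q: "q \<noteq> 0" and \<mu>: "\<mu> \<noteq> 0" and \<eta>: "\<eta> \<in> H_space q \<mu>"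
  shows "\<eta> \<in> Der q \<mu>"
    and "\<exists>c r. \<eta> (Rx q) = qcls q (free_const c * (h_free q ^ r * free_x))
      \<and> \<eta> (Ry q) = qcls q (free_const c * - (h_free q ^ r * free_y))"
proof -
  have "\<eta> \<in> Der q \<mu> \<and> (\<exists>c r. \<eta> (Rx q) = qcls q (free_const c * (h_free q ^ r * free_x))
      \<and> \<eta> (Ry q) = qcls q (free_const c * - (h_free q ^ r * free_y)))"
  proof (cases "\<exists>r::nat. \<mu> = q powi (- int r)")
    case True
    then obtain c r where r: "\<mu> = q powi (- int r)"
      and \<eta>: "\<eta> = (\<lambda>a\<in>carrier (qweyl q). smul q c (H_der q \<mu> r a))"
      using \<eta> by (auto simp: H_space_def)
    note H = H_der_values[OF q r]
    let ?D = "free_der \<mu> (h_free q ^ r * free_x) (- (h_free q ^ r * free_y))"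
    have val: "\<eta> (qcls q a) = qcls q (free_const c * ?D a)" for a
      by (simp add: \<eta> Der_as_free_der[OF \<mu> H])
    have "\<eta> \<in> Der q \<mu>"
    proof (rule DerI[OF \<mu>])
      show "\<eta> \<in> extensional (carrier (qweyl q))" by (simp add: \<eta>)
      show "\<eta> (qcls q (free_const d * a)) = smul q d (\<eta> (qcls q a))" for a d
        by (simp add: val free_der_scale free_const_left_commute[of "free_const c" d])
      show "\<eta> (qcls q (a * b)) = \<eta> (qcls q a) \<otimes>\<^bsub>qweyl q\<^esub> qcls q b
         \<oplus>\<^bsub>qweyl q\<^esub> qcls q (diag_hom \<mu> a) \<otimes>\<^bsub>qweyl q\<^esub> \<eta> (qcls q b)" for a b
        by (simp add: val free_der_mult distrib_left mult.assoc free_const_left_commute[of "diag_hom \<mu> a"])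
    qed (simp_all add: val free_der_add distrib_left)
    moreover have "\<eta> (Rx q) = qcls q (free_const c * (h_free q ^ r * free_x))"
      "\<eta> (Ry q) = qcls q (free_const c * - (h_free q ^ r * free_y))"
      by (simp_all add: Rx_def Ry_def val)
    ultimately show ?thesis by blast
  next
    case False
    then have "\<eta> = zero_map q" using \<eta> by (simp add: H_space_def)
    \<comment> \<open>The zero map fits the common shape with scalar 0.\<close>
    then show ?thesis using \<mu> by (auto simp: zero_map_Der Rx_def Ry_def intro!: exI[of _ 0])
  qed
  then show "\<eta> \<in> Der q \<mu>"
    and "\<exists>c r. \<eta> (Rx q) = qcls q (free_const c * (h_free q ^ r * free_x))
      \<and> \<eta> (Ry q) = qcls q (free_const c * - (h_free q ^ r * free_y))" by blast+
qed

text \<open>h has weight 0, so h^r x and h^r y scale like x and y.\<close>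

lemma rho_in_isotropy_H_space:
  assumes q: "q \<noteq> 0" and \<mu>: "\<mu> \<noteq> 0" and \<eta>: "\<eta> \<in> H_space q \<mu>" and \<beta>: "\<beta> \<noteq> 0"
  shows "rho q \<beta> \<in> isotropy q \<eta>"
proof -
  obtain c r where x: "\<eta> (Rx q) = qcls q (free_const c * (h_free q ^ r * free_x))"
    and y: "\<eta> (Ry q) = qcls q (free_const c * - (h_free q ^ r * free_y))"
    using H_space_cases[OF q \<mu> \<eta>] by blast
  have "nf q (diag_hom \<beta> (h_free q ^ r) * g) = nf q (h_free q ^ r * g)" for g
    by (intro nf_mult_cong refl nf_diag_hom_h_power \<beta>)
  then show ?thesis
    unfolding rho_in_isotropy_Der_iff[OF \<mu> \<beta> H_space_cases(1)[OF q \<mu> \<eta>] x y]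
    by (auto simp: fun_eq_iff nf_scale nf_minus free_const_left_commute[of "diag_hom \<beta> (h_free q ^ r)"]
        free_const_left_commute[of "h_free q ^ r"])
qed

section \<open>The summand spanned by the derivations \<open>X_der\<close> and
  \<open>Y_der\<close>\<close>

lemma free_der_add_values:
  "free_der \<mu> (u + u') (v + v') f = free_der \<mu> u v f + free_der \<mu> u' v' f"
proof (induction f rule: free_induct)
  case (const c)
  show ?case by simp
next
  case (x f)
  then show ?case by (simp add: free_der_x_mult algebra_simps)
next
  case (y f)
  then show ?case by (simp add: free_der_y_mult algebra_simps)
next
  case (add f g)
  then show ?case by (simp add: free_der_add algebra_simps)
qed

lemma free_der_scale_values:
  "free_der \<mu> (free_const c * u) (free_const c * v) f = free_const c * free_der \<mu> u v f"
proof (induction f rule: free_induct)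
  case (const d)
  show ?case by simp
next
  case (x f)
  then show ?case
    by (simp add: free_der_x_mult distrib_left mult.assoc free_const_left_commute[of free_x]
        free_const_left_commute[of "free_const (inverse \<mu>)" c])
next
  case (y f)
  then show ?case
    by (simp add: free_der_y_mult distrib_left mult.assoc free_const_left_commute[of free_y]
        free_const_left_commute[of "free_const \<mu>" c])
next
  case (add f g)
  then show ?case by (simp add: free_der_add distrib_left)
qed

lemma free_der_sum_values:
  "free_der \<mu> (\<Sum>i\<in>A. free_const (s i) * u i) (\<Sum>i\<in>A. free_const (s i) * v i) f
    = (\<Sum>i\<in>A. free_const (s i) * free_der \<mu> (u i) (v i) f)"
proof (induction A rule: infinite_finite_induct)
  case (insert i A)
  then show ?case by (simp add: free_der_add_values free_der_scale_values)
qed (use free_der_scale_values[of \<mu> 0 0 0 f] in simp_all)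

lemma nf_poly_at_y:
  "nf q (\<Sum>n\<le>Polynomial.degree p. free_const (Polynomial.coeff p n) * free_y ^ n) (i, j)
    = (if i = 0 then Polynomial.coeff p j else 0)"
proof -
  have "nf q (free_y ^ n) (i, j) = (if n = j then (if i = 0 then 1 else 0) else 0)" for n
    using nf_monom[of q "(0, n)"] by (auto simp: qmonom_def)
  then show ?thesis
    by (simp add: nf_sum nf_scale if_distrib[of "\<lambda>x. _ * x"] coeff_eq_0 cong: if_cong)
qed

lemma nf_poly_at_x:
  "nf q (\<Sum>n\<le>Polynomial.degree p. free_const (Polynomial.coeff p n) * free_x ^ n) (i, j)
    = (if j = 0 then Polynomial.coeff p i else 0)"
proof -
  have "nf q (free_x ^ n) (i, j) = (if n = i then (if j = 0 then 1 else 0) else 0)" for n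
    using nf_monom[of q "(n, 0)"] by (auto simp: qmonom_def)
  then show ?thesis
    by (simp add: nf_sum nf_scale if_distrib[of "\<lambda>x. _ * x"] coeff_eq_0 cong: if_cong)
qed

text \<open>\<open>Poly\<close> strips trailing zeros, so the degree need not be m - 1; both sums
  are compared over the union of their index sets.\<close>

lemma poly_at_lessThan:
  "poly_at q (Poly (map s [0..<m])) (qcls q f) = qcls q (\<Sum>n<m. free_const (s n) * f ^ n)"
proof -
  let ?p = "Poly (map s [0..<m])"
  have coeff: "Polynomial.coeff ?p n = (if n < m then s n else 0)" for n
    by (simp add: nth_default_def)
  have "(\<Sum>n\<le>Polynomial.degree ?p. free_const (Polynomial.coeff ?p n) * f ^ n)
      = (\<Sum>n\<in>{..Polynomial.degree ?p} \<union> {..<m}. free_const (Polynomial.coeff ?p n) * f ^ n)"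
    by (intro sum.mono_neutral_left) (auto simp: coeff_eq_0 simp del: coeff_Poly_eq)
  also have "\<dots> = (\<Sum>n<m. free_const (s n) * f ^ n)"
    by (intro sum.mono_neutral_cong_right) (auto simp: coeff simp del: coeff_Poly_eq)
  finally show ?thesis by (simp only: poly_at_qcls)
qed

lemma P_space_cases:
  assumes \<mu>: "\<mu> \<noteq> 0" and \<xi>: "\<xi> \<in> P_space q \<mu>"
  shows "\<xi> \<in> Der q \<mu>"
    and "\<exists>a b. \<xi> (Rx q) = poly_at q b (Ry q) \<and> \<xi> (Ry q) = poly_at q a (Rx q)"
proof -
  have "\<xi> \<in> Der q \<mu> \<and> (\<exists>a b. \<xi> (Rx q) = poly_at q b (Ry q) \<and> \<xi> (Ry q) = poly_at q a (Rx q))"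
  proof (cases "\<mu> = q")
    case False
    then have "\<xi> = zero_map q" using \<xi> by (simp add: P_space_def)
    then show ?thesis
      using \<mu> by (auto simp: zero_map_Der Rx_def Ry_def poly_at_qcls intro!: exI[of _ 0])
  next
    case True
    then obtain m n s t where \<xi>: "\<xi> = (\<lambda>a\<in>carrier (qweyl q).
               (\<Oplus>\<^bsub>qweyl q\<^esub> i\<in>{..<m::nat}. smul q (s i) (X_der q \<mu> i a)) \<oplus>\<^bsub>qweyl q\<^esub>
               (\<Oplus>\<^bsub>qweyl q\<^esub> j\<in>{..<n::nat}. smul q (t j) (Y_der q \<mu> j a)))"
      using \<xi> by (auto simp: P_space_def)
    \<comment> \<open>Here \<mu> = q enters: with one value zero, the compatibility equation
      compares a power of a single generator with itself, up to the ratio of \<mu> and q.\<close>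
    have "der_compat q \<mu> (free_y ^ i) 0" "der_compat q \<mu> 0 (free_x ^ i)" for i
      using \<mu> True by (simp_all add: der_compat_def power_commutes flip: free_const_mult mult.assoc)
    note compat = this[THEN der_on_gens_Der(1)[OF \<mu>]] this[THEN der_on_gens_Der(2)[OF \<mu>]]
      this[THEN der_on_gens_Der(3)[OF \<mu>]]
    have XY: "X_der q \<mu> i (qcls q a) = qcls q (free_der \<mu> (free_y ^ i) 0 a)"
      "Y_der q \<mu> i (qcls q a) = qcls q (free_der \<mu> 0 (free_x ^ i) a)" for i a
      unfolding X_der_def Y_der_def
      by (simp_all add: Rx_def Ry_def) (intro Der_as_free_der[OF \<mu>] compat)+
    define u where "u = (\<Sum>i<m. free_const (s i) * free_y ^ i)"
    define v where "v = (\<Sum>j<n. free_const (t j) * free_x ^ j)"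
    have val: "\<xi> (qcls q a) = qcls q (free_der \<mu> u v a)" for a
      using free_der_add_values[of \<mu> u 0 0 v a]
        free_der_sum_values[of \<mu> s "\<lambda>i. free_y ^ i" "{..<m}" "\<lambda>_. 0" a]
        free_der_sum_values[of \<mu> t "\<lambda>_. 0" "{..<n}" "\<lambda>i. free_x ^ i" a]
      by (simp add: \<xi> XY qcls_finsum u_def v_def)
    have "\<xi> \<in> Der q \<mu>"
      by (rule DerI[OF \<mu>])
         (simp_all add: val free_der_add free_der_scale free_der_mult, simp add: \<xi>)
    moreover have "\<xi> (Rx q) = poly_at q (Poly (map s [0..<m])) (Ry q)"
      "\<xi> (Ry q) = poly_at q (Poly (map t [0..<n])) (Rx q)"
      unfolding Rx_def Ry_def poly_at_lessThan by (simp_all add: val u_def v_def)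
    ultimately show ?thesis by blast
  qed
  then show "\<xi> \<in> Der q \<mu>"
    and "\<exists>a b. \<xi> (Rx q) = poly_at q b (Ry q) \<and> \<xi> (Ry q) = poly_at q a (Rx q)" by blast+
qed

text \<open>A monomial y^e of the value at x has weight e but must scale like x, of weight -1, which
  costs a factor \<beta>^(e+1); the monomials x^e of the value at y are symmetric.\<close>

lemma rho_in_isotropy_P_space_iff:
  assumes \<mu>: "\<mu> \<noteq> 0" and \<xi>: "\<xi> \<in> Der q \<mu>" and \<beta>: "\<beta> \<noteq> 0"
    and ab: "\<xi> (Rx q) = poly_at q b (Ry q)" "\<xi> (Ry q) = poly_at q a (Rx q)"
  shows "rho q \<beta> \<in> isotropy q \<xi> \<longleftrightarrow> (\<forall>e\<in>exps a \<union> exps b. \<beta> ^ (e + 1) = 1)"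
proof -
  let ?u = "\<Sum>n\<le>Polynomial.degree b. free_const (Polynomial.coeff b n) * free_y ^ n"
  let ?v = "\<Sum>n\<le>Polynomial.degree a. free_const (Polynomial.coeff a n) * free_x ^ n"
  have x: "\<xi> (Rx q) = qcls q ?u" and y: "\<xi> (Ry q) = qcls q ?v"
    unfolding ab unfolding Rx_def Ry_def poly_at_qcls by (rule refl)+
  have "nf q (diag_hom \<beta> ?u) = nf q (free_const (inverse \<beta>) * ?u)
      \<longleftrightarrow> (\<forall>e. \<beta> ^ e * Polynomial.coeff b e = inverse \<beta> * Polynomial.coeff b e)"
    by (auto simp: fun_eq_iff nf_diag_hom[OF \<beta>] nf_scale nf_poly_at_y simp del: diag_hom_simps)
  also have "\<dots> \<longleftrightarrow> (\<forall>e\<in>exps b. \<beta> ^ (e + 1) = 1)"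
    using \<beta> by (auto simp: exps_def field_simps)
  finally have 1: "nf q (diag_hom \<beta> ?u) = nf q (free_const (inverse \<beta>) * ?u)
      \<longleftrightarrow> (\<forall>e\<in>exps b. \<beta> ^ (e + 1) = 1)" .
  have "nf q (diag_hom \<beta> ?v) = nf q (free_const \<beta> * ?v)
      \<longleftrightarrow> (\<forall>e. inverse (\<beta> ^ e) * Polynomial.coeff a e = \<beta> * Polynomial.coeff a e)"
    by (auto simp: fun_eq_iff nf_diag_hom[OF \<beta>] nf_scale nf_poly_at_x power_int_minus simp del: diag_hom_simps)
  also have "\<dots> \<longleftrightarrow> (\<forall>e\<in>exps a. \<beta> ^ (e + 1) = 1)"
    using \<beta> by (auto simp: exps_def field_simps)
  finally have 2: "nf q (diag_hom \<beta> ?v) = nf q (free_const \<beta> * ?v)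
      \<longleftrightarrow> (\<forall>e\<in>exps a. \<beta> ^ (e + 1) = 1)" .
  show ?thesis
    unfolding rho_in_isotropy_Der_iff[OF \<mu> \<beta> \<xi> x y] 1 2 by blast
qed

section \<open>Roots of unity\<close>

text \<open>Bezout's identity gives the converse; exponents are integers because its cofactors may
  be negative.\<close>

lemma power_eq_1_gcd:
  fixes \<beta> :: "'k::field"
  assumes "\<beta> \<noteq> 0"
  shows "\<beta> powi (gcd m n) = 1 \<longleftrightarrow> \<beta> powi m = 1 \<and> \<beta> powi n = 1"
proof
  assume *: "\<beta> powi (gcd m n) = 1"
  have "\<beta> powi k = 1" if k: "gcd m n dvd k" for k
  proof -
    obtain l where "k = gcd m n * l" using k unfolding dvd_def by blast
    then show ?thesis using * by (simp add: power_int_mult)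
  qed
  then show "\<beta> powi m = 1 \<and> \<beta> powi n = 1" by simp
next
  assume *: "\<beta> powi m = 1 \<and> \<beta> powi n = 1"
  obtain u v where "u * m + v * n = gcd m n" using bezout_int by blast
  then have "\<beta> powi (gcd m n) = \<beta> powi (m * u) * \<beta> powi (n * v)"
    using assms by (metis mult.commute power_int_add)
  then show "\<beta> powi (gcd m n) = 1" using * by (simp add: power_int_mult)
qed

lemma power_eq_1_Gcd:
  fixes \<beta> :: "'k::field"
  assumes "\<beta> \<noteq> 0" "finite A"
  shows "\<beta> powi (Gcd A) = 1 \<longleftrightarrow> (\<forall>k\<in>A. \<beta> powi k = 1)"
  using assms(2)
proof (induction A rule: finite_induct)
  case (insert x A)
  then show ?case by (simp add: power_eq_1_gcd[OF assms(1)])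
qed simp

lemma power_eq_1_Gcd_nat:
  fixes \<beta> :: "'k::field"
  assumes "\<beta> \<noteq> 0" "finite A"
  shows "\<beta> ^ Gcd A = 1 \<longleftrightarrow> (\<forall>k\<in>A. \<beta> ^ k = 1)"
proof -
  have "\<beta> ^ Gcd A = \<beta> powi (Gcd (int ` A))" by (simp add: Gcd_int_eq)
  then show ?thesis using power_eq_1_Gcd[OF assms(1), of "int ` A"] assms(2) by simp
qed

lemma power_gcd_S_eq_1_iff:
  fixes \<beta> :: "'k::field"
  assumes "\<beta> \<noteq> 0"
  shows "\<beta> ^ gcd_S c = 1 \<longleftrightarrow>
    (\<forall>i j. Poly_Mapping.lookup c (i, j) \<noteq> 0 \<longrightarrow> \<beta> powi (int j - int i) = 1)"
proof -
  let ?A = "{int j - int i | i j. Poly_Mapping.lookup c (i, j) \<noteq> 0}"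
  have "?A = (\<lambda>p. int (snd p) - int (fst p)) ` Poly_Mapping.keys c"
    by (force simp: in_keys_iff)
  then have "finite ?A" by simp
  moreover have "\<beta> ^ gcd_S c = \<beta> powi (Gcd ?A)"
    unfolding gcd_S_def by (simp add: power_int_def)
  ultimately have "\<beta> ^ gcd_S c = 1 \<longleftrightarrow> (\<forall>k\<in>?A. \<beta> powi k = 1)"
    using power_eq_1_Gcd[OF assms] by simp
  then show ?thesis by blast
qed

text \<open>Adjoining one prime factor \<open>p\<close> to the order \<open>n\<close> of a root of unity: if \<open>p\<close> divides \<open>n\<close>,
  take a \<open>p\<close>-th root; otherwise multiply by a primitive \<open>p\<close>-th root of unity.\<close>

lemma primitive_root_exists:
  assumes "n > 0"
  shows "\<exists>\<zeta>::'k::{alg_closed_field, field_char_0}. \<forall>k. \<zeta> ^ k = 1 \<longleftrightarrow> n dvd k"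
proof -
  let ?P = "\<lambda>n. \<exists>\<zeta>::'k. \<forall>k. \<zeta> ^ k = 1 \<longleftrightarrow> n dvd k"
  have "n > 0 \<longrightarrow> ?P n"
  proof (induction n rule: prime_divisors_induct)
    case (unit x)
    show ?case using unit by (intro impI exI[of _ 1]) auto
  next
    case (factor p n)
    show ?case
    proof
      assume "p * n > 0"
      then obtain \<omega> :: 'k where \<omega>: "\<And>k. \<omega> ^ k = 1 \<longleftrightarrow> n dvd k"
        using factor.IH by auto
      have p: "p > 0" "p \<noteq> 1" using \<open>prime p\<close> prime_gt_1_nat by (auto simp: prime_gt_0_nat)
      have n0: "n > 0" using \<open>p * n > 0\<close> by simp
      show "?P (p * n)"
      proof (cases "p dvd n")
        case True
        obtain \<zeta> where \<zeta>: "\<zeta> ^ p = \<omega>" using nth_root_exists[OF p(1)] by blast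
        have \<zeta>p: "\<zeta> ^ (p * k) = 1 \<longleftrightarrow> n dvd k" for k by (simp add: power_mult \<zeta> \<omega>)
        have "\<zeta> ^ k = 1 \<longleftrightarrow> p * n dvd k" for k
        proof
          assume k: "\<zeta> ^ k = 1"
          have "\<zeta> ^ (p * k) = 1" using k by (simp add: power_mult mult.commute[of p])
          then have "p dvd k" using \<zeta>p True by (meson dvd_trans)
          then obtain l where l: "k = p * l" unfolding dvd_def by blast
          with k \<zeta>p show "p * n dvd k" by simp
        next
          assume "p * n dvd k"
          then show "\<zeta> ^ k = 1" using \<zeta>p by (auto elim!: dvdE simp: mult.assoc)
        qed
        then show ?thesis by blast
      next
        case False
        have cop: "coprime p n" using False \<open>prime p\<close> by (simp add: prime_imp_coprime)
        \<comment> \<open>A root of 1 + X + ... + X^(p-1) is a p-th root of unity, and it differs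
          from 1 because the value at 1 is p, nonzero in characteristic 0.\<close>
        obtain \<epsilon> :: 'k where \<epsilon>: "(\<Sum>k\<le>p - 1. (1::'k) * \<epsilon> ^ k) = 0"
          using alg_closed[of "p - 1" "\<lambda>_. 1::'k"] p by auto
        have "\<epsilon> ^ p - 1 = (\<epsilon> - 1) * (\<Sum>k<p. \<epsilon> ^ k)" by (rule power_diff_1_eq)
        also have "{..<p} = {..p - 1}" using p by auto
        finally have \<epsilon>p: "\<epsilon> ^ p = 1" using \<epsilon> by simp
        have \<epsilon>1: "\<epsilon> \<noteq> 1" using \<epsilon> p by auto
        have \<epsilon>dvd: "\<epsilon> ^ k = 1 \<longleftrightarrow> p dvd k" for k
        proof
          assume k: "\<epsilon> ^ k = 1"
          show "p dvd k"
          proof (rule ccontr)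
            assume "\<not> p dvd k"
            then have "gcd (int p) (int k) = 1"
              using \<open>prime p\<close> by (simp add: prime_imp_coprime)
            moreover have "\<epsilon> powi (gcd (int p) (int k)) = 1"
              using k \<epsilon>p p by (subst power_eq_1_gcd) (auto simp: power_0_left)
            ultimately show False using \<epsilon>1 by simp
          qed
        qed (use \<epsilon>p in \<open>auto elim!: dvdE simp: power_mult\<close>)
        have "(\<epsilon> * \<omega>) ^ k = 1 \<longleftrightarrow> p * n dvd k" for k
        proof
          assume k: "(\<epsilon> * \<omega>) ^ k = 1"
          have "(\<epsilon> * \<omega>) ^ (k * p) = 1" "(\<epsilon> * \<omega>) ^ (k * n) = 1" by (simp_all add: power_mult k)
          moreover have "\<epsilon> ^ (k * p) = 1" "\<omega> ^ (k * n) = 1" by (simp_all add: \<epsilon>dvd \<omega>)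
          ultimately have "\<omega> ^ (k * p) = 1" "\<epsilon> ^ (k * n) = 1" by (simp_all add: power_mult_distrib)
          then have "n dvd k" "p dvd k"
            using cop by (simp_all add: \<epsilon>dvd \<omega> coprime_dvd_mult_left_iff coprime_commute)
          then show "p * n dvd k" using cop by (simp add: divides_mult)
        next
          assume "p * n dvd k"
          then have "p dvd k" "n dvd k" by (auto dest: dvd_mult_left dvd_mult_right)
          then have "\<epsilon> ^ k = 1" "\<omega> ^ k = 1" by (simp_all only: \<epsilon>dvd \<omega>)
          then show "(\<epsilon> * \<omega>) ^ k = 1" by (simp add: power_mult_distrib)
        qed
        then show ?thesis by blast
      qed
    qed
  qed simp
  then show ?thesis using assms by simp
qed

text \<open>The powers of \<open>\<zeta>\<close> with exponent below n are n distinct roots of X^n -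
  1, which has at most n roots.\<close>

lemma roots_of_unity_bij:
  fixes \<zeta> :: "'k::field"
  assumes n: "n > 0" and \<zeta>: "\<And>k. \<zeta> ^ k = 1 \<longleftrightarrow> n dvd k"
  shows "bij_betw (\<lambda>k. \<zeta> ^ nat k) {0..<int n} {\<beta>. \<beta> ^ n = 1}"
proof -
  have \<zeta>0: "\<zeta> \<noteq> 0" using \<zeta>[of n] n by (auto simp: power_0_left)
  have *: "\<zeta> ^ a \<noteq> \<zeta> ^ b" if "a < b" "b < n" for a b
  proof
    assume "\<zeta> ^ a = \<zeta> ^ b"
    also have "\<zeta> ^ b = \<zeta> ^ a * \<zeta> ^ (b - a)" using that by (simp flip: power_add)
    finally have "\<zeta> ^ (b - a) = 1" using \<zeta>0 by simp
    then show False using \<zeta> that by (auto dest: dvd_imp_le)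
  qed
  have inj: "inj_on (\<lambda>k. \<zeta> ^ nat k) {0..<int n}"
  proof (rule inj_onI)
    fix a b assume ab: "a \<in> {0..<int n}" "b \<in> {0..<int n}" and eq: "\<zeta> ^ nat a = \<zeta> ^ nat b"
    have "nat a < n" "nat b < n" using ab by auto
    then have "\<not> nat a < nat b" "\<not> nat b < nat a"
      using *[of "nat a" "nat b"] *[of "nat b" "nat a"] eq by auto
    then show "a = b" using ab by auto
  qed
  let ?p = "Polynomial.monom 1 n - 1 :: 'k poly"
  have roots: "{\<beta>. \<beta> ^ n = 1} = {\<beta>. poly ?p \<beta> = 0}" by (simp add: poly_monom)
  have "Polynomial.coeff ?p n = 1" using n by simp
  then have p0: "?p \<noteq> 0" by (metis coeff_0 zero_neq_one)
  have "Polynomial.degree ?p \<le> n"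
    by (rule degree_diff_le) (simp_all add: degree_monom_le)
  then have "card {\<beta>::'k. \<beta> ^ n = 1} \<le> n"
    using card_poly_roots_bound[OF p0] unfolding roots by linarith
  moreover have fin: "finite {\<beta>::'k. \<beta> ^ n = 1}"
    unfolding roots by (rule poly_roots_finite[OF p0])
  moreover have sub: "(\<lambda>k. \<zeta> ^ nat k) ` {0..<int n} \<subseteq> {\<beta>. \<beta> ^ n = 1}"
  proof (clarsimp)
    fix k
    have "(\<zeta> ^ nat k) ^ n = \<zeta> ^ (nat k * n)" by (simp add: power_mult)
    then show "(\<zeta> ^ nat k) ^ n = 1" by (simp add: \<zeta>)
  qed
  moreover have "card ((\<lambda>k. \<zeta> ^ nat k) ` {0..<int n}) = n"
    using card_image[OF inj] by simp
  ultimately have "(\<lambda>k. \<zeta> ^ nat k) ` {0..<int n} = {\<beta>. \<beta> ^ n = 1}"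
    by (intro card_subset_eq) (auto dest: card_mono[OF fin])
  then show ?thesis using inj by (simp add: bij_betw_def)
qed

section \<open>Groups of diagonal automorphisms\<close>

lemma rho_inj:
  assumes "\<beta> \<noteq> 0" "\<gamma> \<noteq> 0" "rho q \<beta> = rho q \<gamma>"
  shows "\<beta> = \<gamma>"
proof -
  have "qcls q (free_const \<beta> * free_y) = rho q \<beta> (qcls q free_y)" by (simp add: rho_qcls assms(1))
  also have "\<dots> = qcls q (free_const \<gamma> * free_y)" unfolding assms(3) by (simp add: rho_qcls assms(2))
  finally have "nf q (free_const \<beta> * free_y) (0, 1) = nf q (free_const \<gamma> * free_y) (0, 1)"
    by (simp only: qcls_eq_iff)
  then show ?thesis by (simp add: nf_scale nf_y)
qed

lemma rho_compose:
  assumes "\<beta> \<noteq> 0" "\<gamma> \<noteq> 0"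
  shows "compose (carrier (qweyl q)) (rho q \<beta>) (rho q \<gamma>) = rho q (\<beta> * \<gamma>)"
proof (rule extensionalityI[of _ "carrier (qweyl q)"])
  show "rho q (\<beta> * \<gamma>) \<in> extensional (carrier (qweyl q))"
    using assms by (intro Aut_extensional rho_Aut) auto
  fix a assume "a \<in> carrier (qweyl q)"
  then obtain s where "a = qcls q s" by (rule qcls_cases)
  then show "compose (carrier (qweyl q)) (rho q \<beta>) (rho q \<gamma>) a = rho q (\<beta> * \<gamma>) a"
    using assms by (simp add: compose_def rho_qcls qcls_eq_iff nf_diag_hom_diag_hom)
qed simp

lemma rho_1: "rho q 1 = Id_R q"
proof (rule extensionalityI[of _ "carrier (qweyl q)"])
  show "rho q 1 \<in> extensional (carrier (qweyl q))"
    by (intro Aut_extensional rho_Aut) auto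
  fix a assume "a \<in> carrier (qweyl q)"
  then obtain s where "a = qcls q s" by (rule qcls_cases)
  then show "rho q 1 a = Id_R q a"
    by (simp add: rho_qcls Id_R_def qcls_eq_iff nf_diag_hom_1)
qed (simp add: Id_R_def)

lemma rho_Bij: "\<beta> \<noteq> 0 \<Longrightarrow> rho q \<beta> \<in> Bij (carrier (qweyl q))"
  using rho_Aut[of \<beta> q] by (auto simp: Aut_def)

lemma rho_group_mult:
  assumes "\<beta> \<noteq> 0" "\<gamma> \<noteq> 0"
  shows "rho q \<beta> \<otimes>\<^bsub>Aut_subgroup q A\<^esub> rho q \<gamma> = rho q (\<beta> * \<gamma>)"
  using assms by (simp add: BijGroup_def rho_Bij rho_compose)

lemma rho_group_iso_kstar:
  fixes q :: "'k::field"
  shows "Aut_subgroup q (rho q ` {\<beta>. \<beta> \<noteq> 0}) \<cong> (kstar :: 'k monoid)"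
proof -
  have "field (ring_of_type_algebra :: 'k ring)" by (rule field_from_type_algebra)
  then interpret K: field "ring_of_type_algebra :: 'k ring" .
  have kstar: "carrier (kstar :: 'k monoid) = {\<beta>. \<beta> \<noteq> 0}"
    using K.field_Units by (auto simp: units_of_def ring_of_type_algebra_def)
  have "group (kstar :: 'k monoid)" by (rule K.units_group)
  moreover have "rho q \<in> iso (kstar :: 'k monoid) (Aut_subgroup q (rho q ` {\<beta>. \<beta> \<noteq> 0}))"
    unfolding iso_def
  proof (intro CollectI conjI homI)
    fix \<beta> \<gamma> :: 'k
    assume "\<beta> \<in> carrier kstar" "\<gamma> \<in> carrier kstar"
    then have "\<beta> \<noteq> 0" "\<gamma> \<noteq> 0" by (simp_all add: kstar)
    moreover have "\<beta> \<otimes>\<^bsub>kstar\<^esub> \<gamma> = \<beta> * \<gamma>" by (simp add: units_of_def ring_of_type_algebra_def)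
    ultimately show "rho q (\<beta> \<otimes>\<^bsub>kstar\<^esub> \<gamma>) = rho q \<beta> \<otimes>\<^bsub>Aut_subgroup q (rho q ` {\<beta>. \<beta> \<noteq> 0})\<^esub> rho q \<gamma>"
      by (simp only:) (rule rho_group_mult[symmetric])
  qed (auto simp: kstar bij_betw_def inj_on_def intro: rho_inj)
  ultimately show ?thesis using group.iso_sym[of "kstar :: 'k monoid"] unfolding is_iso_def by blast
qed

text \<open>Composes the map from residues k to powers of a primitive n-th root of unity with
  \<open>rho q\<close>, which is multiplicative and injective on nonzero scalars.\<close>

lemma rho_group_iso_cyclic:
  fixes q :: "'k::{alg_closed_field, field_char_0}"
  assumes n: "n > 0"
  shows "Aut_subgroup q (rho q ` {\<beta>. \<beta> ^ n = 1}) \<cong> integer_mod_group n"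
proof -
  obtain \<zeta> :: 'k where \<zeta>: "\<And>k. \<zeta> ^ k = 1 \<longleftrightarrow> n dvd k" using primitive_root_exists[OF n] by blast
  have \<zeta>0: "\<zeta> \<noteq> 0" using \<zeta>[of n] n by (auto simp: power_0_left)
  have nz: "\<beta> \<noteq> 0" if "\<beta> ^ n = 1" for \<beta> :: 'k using that n by (auto simp: power_0_left)
  have bij: "bij_betw (\<lambda>k. \<zeta> ^ nat k) {0..<int n} {\<beta>. \<beta> ^ n = 1}"
    by (rule roots_of_unity_bij[OF n \<zeta>])
  have bij': "bij_betw (rho q) {\<beta>. \<beta> ^ n = 1} (rho q ` {\<beta>. \<beta> ^ n = 1})"
    by (auto simp: bij_betw_def inj_on_def intro: rho_inj[OF nz nz, where q = q])
  have "rho q \<circ> (\<lambda>k. \<zeta> ^ nat k) \<in> iso (integer_mod_group n) (Aut_subgroup q (rho q ` {\<beta>. \<beta> ^ n = 1}))"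
    unfolding iso_def
  proof (intro CollectI conjI homI)
    fix a b assume ab: "a \<in> carrier (integer_mod_group n)" "b \<in> carrier (integer_mod_group n)"
    then have ab': "0 \<le> a" "0 \<le> b" using n by (auto simp: carrier_integer_mod_group)
    then have "nat ((a + b) mod int n) = (nat a + nat b) mod n"
      by (simp add: nat_mod_distrib nat_add_distrib)
    moreover have "\<zeta> ^ (k mod n) = \<zeta> ^ k" for k
    proof -
      have "\<zeta> ^ k = \<zeta> ^ (n * (k div n)) * \<zeta> ^ (k mod n)" by (simp flip: power_add)
      then show ?thesis using \<zeta>[of "n * (k div n)"] by simp
    qed
    ultimately have "\<zeta> ^ nat ((a + b) mod int n) = \<zeta> ^ nat a * \<zeta> ^ nat b" by (simp add: power_add)
    then show "(rho q \<circ> (\<lambda>k. \<zeta> ^ nat k)) (a \<otimes>\<^bsub>integer_mod_group n\<^esub> b) =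
      (rho q \<circ> (\<lambda>k. \<zeta> ^ nat k)) a \<otimes>\<^bsub>Aut_subgroup q (rho q ` {\<beta>. \<beta> ^ n = 1})\<^esub> (rho q \<circ> (\<lambda>k. \<zeta> ^ nat k)) b"
      using \<zeta>0 by (simp only: comp_apply mult_integer_mod_group) (subst rho_group_mult, simp_all)
  next
    show "bij_betw (rho q \<circ> (\<lambda>k. \<zeta> ^ nat k)) (carrier (integer_mod_group n))
       (carrier (Aut_subgroup q (rho q ` {\<beta>. \<beta> ^ n = 1})))"
      using bij_betw_trans[OF bij bij'] n by (simp add: carrier_integer_mod_group)
    show "(rho q \<circ> (\<lambda>k. \<zeta> ^ nat k)) a \<in> carrier (Aut_subgroup q (rho q ` {\<beta>. \<beta> ^ n = 1}))"
      if "a \<in> carrier (integer_mod_group n)" for a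
      using bij_betwE[OF bij] that n by (auto simp: carrier_integer_mod_group)
  qed
  then show ?thesis using group.iso_sym[OF group_integer_mod_group] unfolding is_iso_def by blast
qed

section \<open>Isotropy of a decomposed derivation\<close>

lemma isotropy_eq_rho_image:
  assumes "q \<noteq> 0" "\<And>n::nat. n > 0 \<Longrightarrow> q ^ n \<noteq> 1"
    and "\<And>\<beta>. \<beta> \<noteq> 0 \<Longrightarrow> rho q \<beta> \<in> isotropy q d \<longleftrightarrow> P \<beta>"
  shows "isotropy q d = rho q ` {\<beta>. \<beta> \<noteq> 0 \<and> P \<beta>}"
proof (intro equalityI subsetI)
  fix f assume f: "f \<in> isotropy q d"
  then have "f \<in> Aut q" using isotropy_subset_Aut by blast
  then obtain \<beta> where "\<beta> \<noteq> 0" "f = rho q \<beta>" using Aut_is_rho[OF assms(1,2)] by blast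
  with f assms(3) show "f \<in> rho q ` {\<beta>. \<beta> \<noteq> 0 \<and> P \<beta>}" by auto
qed (use assms(3) in auto)

text \<open>The part \<open>\<eta>\<close> always scales correctly and drops out of the criterion.
  What remains is that \<open>?fix\<close> for the sum of the inner part and \<open>\<xi>\<close>
  implies \<open>?fix\<close> for the inner part; subtraction then gives it for
  \<open>\<xi>\<close>.\<close>

lemma isotropy_decomposition:
  assumes q: "q \<noteq> 0" "\<And>n::nat. n > 0 \<Longrightarrow> q ^ n \<noteq> 1" and \<mu>: "\<mu> \<noteq> 0" and \<beta>: "\<beta> \<noteq> 0"
    and \<delta>: "\<delta> \<in> Der q \<mu>" and \<eta>: "\<eta> \<in> H_space q \<mu>" and \<xi>: "\<xi> \<in> P_space q \<mu>"
    and dec: "\<And>f. \<delta> (qcls q f) = Inner q \<mu> (qcls q w) (qcls q f) \<oplus>\<^bsub>qweyl q\<^esub> \<eta> (qcls q f) \<oplus>\<^bsub>qweyl q\<^esub> \<xi> (qcls q f)"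
  shows "rho q \<beta> \<in> isotropy q \<delta> \<longleftrightarrow>
    rho q \<beta> \<in> isotropy q (Inner q \<mu> (qcls q w)) \<and> rho q \<beta> \<in> isotropy q \<xi>"
proof -
  note \<xi>D = P_space_cases(1)[OF \<mu> \<xi>]
  note \<eta>D = H_space_cases(1)[OF q(1) \<mu> \<eta>]
  define ux where "ux = w * free_x - free_const (inverse \<mu>) * (free_x * w)"
  define uy where "uy = w * free_y - free_const \<mu> * (free_y * w)"
  have u: "Inner q \<mu> (qcls q w) (Rx q) = qcls q ux" "Inner q \<mu> (qcls q w) (Ry q) = qcls q uy"
    by (simp_all add: Inner_x[OF \<mu>] Inner_y[OF \<mu>] ux_def uy_def)
  obtain ex ey where e: "\<eta> (Rx q) = qcls q ex" "\<eta> (Ry q) = qcls q ey"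
    using Der_values_on_gens[OF \<eta>D \<mu>] by blast
  obtain b a where ab: "\<xi> (Rx q) = poly_at q b (Ry q)" "\<xi> (Ry q) = poly_at q a (Rx q)"
    using P_space_cases(2)[OF \<mu> \<xi>] by blast
  define sx where "sx = (\<Sum>n\<le>Polynomial.degree b. free_const (Polynomial.coeff b n) * free_y ^ n)"
  define sy where "sy = (\<Sum>n\<le>Polynomial.degree a. free_const (Polynomial.coeff a n) * free_x ^ n)"
  have s: "\<xi> (Rx q) = qcls q sx" "\<xi> (Ry q) = qcls q sy"
    unfolding ab unfolding Rx_def Ry_def poly_at_qcls sx_def sy_def by (rule refl)+
  have d: "\<delta> (Rx q) = qcls q (ux + ex + sx)" "\<delta> (Ry q) = qcls q (uy + ey + sy)"
    using dec[of free_x] dec[of free_y] u e s by (simp_all add: Rx_def Ry_def)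
  let ?fix = "\<lambda>ux uy. nf q (diag_hom \<beta> ux) = nf q (free_const (inverse \<beta>) * ux)
    \<and> nf q (diag_hom \<beta> uy) = nf q (free_const \<beta> * uy)"
  note iff = rho_in_isotropy_Der_iff[OF \<mu> \<beta>]
  have e_fix: "?fix ex ey"
    using rho_in_isotropy_H_space[OF q(1) \<mu> \<eta> \<beta>] unfolding iff[OF \<eta>D e] .
  have d_fix: "?fix (ux + ex + sx) (uy + ey + sy) \<longleftrightarrow> ?fix (ux + sx) (uy + sy)"
    using e_fix by (auto simp: fun_eq_iff nf_add nf_scale distrib_left)
  have "?fix (ux + sx) (uy + sy) \<longleftrightarrow> ?fix ux uy \<and> ?fix sx sy"
  proof
    assume fix_sum: "?fix (ux + sx) (uy + sy)"
    have "?fix ux uy"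
    proof (cases "\<mu> = q")
      case False
      then have "\<xi> = zero_map q" using \<xi> by (simp add: P_space_def)
      then have "nf q sx = nf q 0" "nf q sy = nf q 0"
        using s by (simp_all add: Rx_def Ry_def qcls_eq_iff)
      then have "nf q (diag_hom \<beta> sx) (i, j) = 0" "nf q (diag_hom \<beta> sy) (i, j) = 0"
        "nf q sx (i, j) = 0" "nf q sy (i, j) = 0" for i j
        by (simp_all add: nf_diag_hom \<beta>)
      then show ?thesis using fix_sum by (simp add: fun_eq_iff nf_add nf_scale)
    next
      case True
      let ?w = "diag_hom \<beta> w"
      let ?v = "?w - w"
      \<comment> \<open>The value of \<open>\<xi>\<close> at x is a polynomial in y, so coefficients
        with a positive exponent of x see only the inner part. This suffices for
        \<open>skew_commutator_x_eq_0\<close>.\<close>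
      have vx: "nf q (?v * free_x - free_const (inverse q) * (free_x * ?v)) (Suc i, j) = 0" for i j
      proof -
        have "nf q (diag_hom \<beta> ux) (Suc i, j) = inverse \<beta> * nf q ux (Suc i, j)"
          using conjunct1[OF fix_sum, THEN fun_cong, of "(Suc i, j)"]
          by (simp add: nf_add nf_scale nf_diag_hom \<beta> sx_def nf_poly_at_y del: diag_hom_simps
              add: diag_hom_simps(1))
        then have "nf q (free_const \<beta> * diag_hom \<beta> ux) (Suc i, j) = nf q ux (Suc i, j)"
          using \<beta> by (simp add: nf_scale)
        then have "nf q (free_const \<beta> * diag_hom \<beta> ux - ux) (Suc i, j) = 0"
          by (simp only: nf_diff) simp
        then show ?thesis
          unfolding ux_def diag_hom_skew_commutator_x[OF \<beta>] skew_commutator_diff True .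
      qed
      have v0: "nf q ?v = (\<lambda>_. 0)" by (rule skew_commutator_x_eq_0[OF q]) (assumption | rule vx)+
      have "\<beta> powi (int j - int i) = 1" if "nf q w (i, j) \<noteq> 0" for i j
        using fun_cong[OF v0, of "(i, j)"] that \<beta> by (simp add: nf_diff nf_diag_hom)
      then have "rho q \<beta> \<in> isotropy q (Inner q \<mu> (qcls q w))"
        using rho_in_isotropy_Inner_iff[OF q(2) \<mu> \<beta>] by blast
      then show ?thesis unfolding iff[OF Inner_Der[OF \<mu>] u] .
    qed
    then show "?fix ux uy \<and> ?fix sx sy"
      using fix_sum by (auto simp: fun_eq_iff nf_add nf_scale distrib_left)
  qed (auto simp: fun_eq_iff nf_add nf_scale distrib_left)
  then show ?thesis
    unfolding iff[OF \<delta> d] d_fix iff[OF Inner_Der[OF \<mu>] u] iff[OF \<xi>D s] .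
qed

lemma isotropy_zero_map:
  assumes "q \<noteq> 0" "\<And>n::nat. n > 0 \<Longrightarrow> q ^ n \<noteq> 1"
  shows "isotropy q (zero_map q) = Aut q"
  by (rule isotropy_eq_Aut[OF assms]) (auto intro: rho_in_isotropy_zero_map)

lemma isotropy_P_space_cyclic:
  fixes q \<mu> :: "'k::{alg_closed_field, field_char_0}"
  assumes q: "q \<noteq> 0" "\<And>n::nat. n > 0 \<Longrightarrow> q ^ n \<noteq> 1" and \<mu>: "\<mu> \<noteq> 0"
    and \<xi>: "\<xi> \<in> Der q \<mu>" "\<xi> \<noteq> zero_map q"
    and ab: "\<xi> (Rx q) = poly_at q b (Ry q)" "\<xi> (Ry q) = poly_at q a (Rx q)"
  shows "Aut_subgroup q (isotropy q \<xi>) \<cong> integer_mod_group (Gcd {e + 1 | e. e \<in> exps a \<union> exps b})"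
proof -
  let ?E = "exps a \<union> exps b"
  define D where "D = Gcd {e + 1 | e. e \<in> ?E}"
  have "e \<le> Polynomial.degree p" if "e \<in> exps p" for e and p :: "'k poly"
    using that by (simp add: exps_def le_degree)
  then have "?E \<subseteq> {..max (Polynomial.degree a) (Polynomial.degree b)}"
    by (auto simp: le_max_iff_disj)
  then have fin: "finite ?E" by (rule finite_subset) simp
  have "?E \<noteq> {}"
  proof
    assume "?E = {}"
    then have "a = 0" "b = 0" by (auto simp: exps_def poly_eq_iff)
    then have "\<xi> (Rx q) = zero_map q (Rx q)" "\<xi> (Ry q) = zero_map q (Ry q)"
      using ab by (simp_all add: Rx_def Ry_def poly_at_qcls)
    then show False using Der_eqI[OF \<mu> \<xi>(1) zero_map_Der[OF \<mu>]] \<xi>(2) by blast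
  qed
  then obtain e where "e \<in> ?E" by blast
  \<comment> \<open>A nonzero \<open>\<xi>\<close> has some exponent e, and dividing the positive
    number e + 1 makes D positive, so the group is finite cyclic.\<close>
  then have "D dvd e + 1" unfolding D_def by (intro Gcd_dvd) blast
  then have D: "D > 0" by (auto intro!: Nat.gr0I)
  have set: "{e + 1 | e. e \<in> ?E} = (\<lambda>e. e + 1) ` ?E" by auto
  have "isotropy q \<xi> = rho q ` {\<beta>. \<beta> \<noteq> 0 \<and> (\<forall>e\<in>?E. \<beta> ^ (e + 1) = 1)}"
    by (rule isotropy_eq_rho_image[OF q]) (assumption | rule rho_in_isotropy_P_space_iff[OF \<mu> \<xi>(1) _ ab])+
  also have "{\<beta>::'k. \<beta> \<noteq> 0 \<and> (\<forall>e\<in>?E. \<beta> ^ (e + 1) = 1)} = {\<beta>. \<beta> ^ D = 1}"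
  proof -
    have 1: "\<beta> ^ D = 1 \<longleftrightarrow> (\<forall>e\<in>?E. \<beta> ^ (e + 1) = 1)" if "\<beta> \<noteq> 0" for \<beta> :: 'k
      unfolding D_def set using fin by (subst power_eq_1_Gcd_nat[OF that]) auto
    have 2: "\<beta> \<noteq> 0" if "\<beta> ^ D = 1" for \<beta> :: 'k
      using that D by (auto simp: power_0_left)
    show ?thesis using 1 2 by blast
  qed
  finally show ?thesis using rho_group_iso_cyclic[OF D, of q] unfolding D_def by simp
qed

theorem corollary13:
  fixes q \<mu> :: "'k::{alg_closed_field, field_char_0}"
    and w :: "'k free set"
    and \<delta> \<eta> \<xi> :: "'k free set \<Rightarrow> 'k free set"
  assumes q: "q \<noteq> 0" "\<And>n::nat. n > 0 \<Longrightarrow> q ^ n \<noteq> 1"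
    and mu: "\<mu> \<noteq> 0"
    and delta: "\<delta> \<in> Der q \<mu>"
    and w: "w \<in> carrier (qweyl q)"
    and eta: "\<eta> \<in> H_space q \<mu>"
    and xi: "\<xi> \<in> P_space q \<mu>"
    and decomposition: "\<And>a. a \<in> carrier (qweyl q) \<Longrightarrow>
          \<delta> a = Inner q \<mu> w a \<oplus>\<^bsub>qweyl q\<^esub> \<eta> a \<oplus>\<^bsub>qweyl q\<^esub> \<xi> a"
  shows
    "isotropy q \<delta> = isotropy q (Inner q \<mu> w) \<inter> isotropy q \<eta> \<inter> isotropy q \<xi>
     \<and> isotropy q \<delta> = Aut q \<inter> (\<Inter>\<zeta>\<in>{Inner q \<mu> w, \<eta>, \<xi>} - {zero_map q}. isotropy q \<zeta>)
     \<and> isotropy q \<eta> = Aut q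
     \<and> (\<xi> \<noteq> zero_map q \<longrightarrow>
          (\<exists>a b. \<xi> (Rx q) = poly_at q b (Ry q) \<and> \<xi> (Ry q) = poly_at q a (Rx q))
          \<and> (\<forall>a b. \<xi> (Rx q) = poly_at q b (Ry q) \<and> \<xi> (Ry q) = poly_at q a (Rx q) \<longrightarrow>
               Aut_subgroup q (isotropy q \<xi>)
                 \<cong> integer_mod_group (Gcd {e + 1 | e. e \<in> exps a \<union> exps b})))
     \<and> (\<exists>c. w = xy_sum q c)
     \<and> (\<forall>c. w = xy_sum q c \<longrightarrow>
          (\<forall>\<beta>. \<beta> \<noteq> 0 \<and> rho q \<beta> \<noteq> Id_R q \<longrightarrow>
             (rho q \<beta> \<in> isotropy q (Inner q \<mu> w) \<longleftrightarrow> \<beta> ^ gcd_S c = 1))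
          \<and> (w = (\<Oplus>\<^bsub>qweyl q\<^esub> i\<in>{i. (i, i) \<in> Poly_Mapping.keys c}.
                   smul q (Poly_Mapping.lookup c (i, i))
                     (Rx q [^]\<^bsub>qweyl q\<^esub> i \<otimes>\<^bsub>qweyl q\<^esub> Ry q [^]\<^bsub>qweyl q\<^esub> i)) \<longrightarrow>
               Aut_subgroup q (isotropy q (Inner q \<mu> w)) \<cong> (kstar :: 'k monoid))
          \<and> (gcd_S c \<notin> {0, 1} \<longrightarrow>
               Aut_subgroup q (isotropy q (Inner q \<mu> w)) \<cong> integer_mod_group (gcd_S c))
          \<and> (gcd_S c = 1 \<longrightarrow>
               Aut_subgroup q (isotropy q (Inner q \<mu> w)) \<cong> Aut_subgroup q {Id_R q}))
     \<and> isotropy q \<delta> = isotropy q (Inner q \<mu> w) \<inter> isotropy q \<xi>"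
proof -
  obtain W where W: "w = qcls q W" using w by (rule qcls_cases)
  let ?I = "Inner q \<mu> w"
  have ID: "?I \<in> Der q \<mu>" unfolding W by (rule Inner_Der[OF mu])
  have \<xi>D: "\<xi> \<in> Der q \<mu>" by (rule P_space_cases(1)[OF mu xi])
  have eta_Aut: "isotropy q \<eta> = Aut q"
    by (rule isotropy_eq_Aut[OF q]) (assumption | rule rho_in_isotropy_H_space[OF q(1) mu eta])+
  have main: "isotropy q \<delta> = isotropy q ?I \<inter> isotropy q \<xi>"
  proof -
    have "rho q \<beta> \<in> isotropy q \<delta> \<longleftrightarrow> rho q \<beta> \<in> isotropy q ?I \<and> rho q \<beta> \<in> isotropy q \<xi>"
      if "\<beta> \<noteq> 0" for \<beta>
      unfolding W
      by (rule isotropy_decomposition[OF q mu that delta eta xi])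
         (assumption | rule decomposition[unfolded W] qcls_carrier)+
    then have "f \<in> isotropy q \<delta> \<longleftrightarrow> f \<in> isotropy q ?I \<and> f \<in> isotropy q \<xi>" if "f \<in> Aut q" for f
      using Aut_is_rho[OF q that] by metis
    then show ?thesis using isotropy_subset_Aut by blast
  qed
  have iso_I: "rho q \<beta> \<in> isotropy q ?I \<longleftrightarrow> \<beta> ^ gcd_S c = 1"
    if "\<beta> \<noteq> 0" "w = xy_sum q c" for \<beta> c
  proof -
    have "nf q W = Poly_Mapping.lookup c"
      using that(2) by (simp add: W xy_sum_qcls qcls_eq_iff fun_eq_iff nf_from_coeffs)
    moreover have "rho q \<beta> \<in> isotropy q ?I \<longleftrightarrow>
        (\<forall>i j. nf q W (i, j) \<noteq> 0 \<longrightarrow> \<beta> powi (int j - int i) = 1)"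
      unfolding W by (rule rho_in_isotropy_Inner_iff[OF _ mu that(1)]) (rule q)
    ultimately show ?thesis by (simp add: power_gcd_S_eq_1_iff[OF that(1)])
  qed
  have iso_I': "isotropy q ?I = rho q ` {\<beta>. \<beta> \<noteq> 0 \<and> \<beta> ^ gcd_S c = 1}" if "w = xy_sum q c" for c
    by (rule isotropy_eq_rho_image[OF q]) (assumption | rule iso_I that)+
  have split: "isotropy q \<delta> = isotropy q ?I \<inter> isotropy q \<eta> \<inter> isotropy q \<xi>"
    using main eta_Aut isotropy_subset_Aut by blast
  \<comment> \<open>The zero map is fixed by all automorphisms, so omitting zero components leaves
    the intersection unchanged; \<open>Aut q\<close> covers the case in which all of them are
    omitted.\<close>
  have split_nonzero: "isotropy q \<delta> = Aut q \<inter> (\<Inter>\<zeta>\<in>{?I, \<eta>, \<xi>} - {zero_map q}. isotropy q \<zeta>)"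
    using main eta_Aut isotropy_subset_Aut[of q ?I] isotropy_subset_Aut[of q \<xi>]
      isotropy_zero_map[OF q] by auto
  have gens: "\<exists>a b. \<xi> (Rx q) = poly_at q b (Ry q) \<and> \<xi> (Ry q) = poly_at q a (Rx q)"
    by (rule P_space_cases(2)[OF mu xi])
  have cyclic_P: "Aut_subgroup q (isotropy q \<xi>) \<cong> integer_mod_group (Gcd {e + 1 | e. e \<in> exps a \<union> exps b})"
    if "\<xi> \<noteq> zero_map q" "\<xi> (Rx q) = poly_at q b (Ry q)" "\<xi> (Ry q) = poly_at q a (Rx q)" for a b
    by (rule isotropy_P_space_cyclic[OF q mu \<xi>D that])
  have normal_form: "\<exists>c. w = xy_sum q c"
    using ex_from_coeffs[of W q] by (simp add: W xy_sum_qcls qcls_eq_iff qweyl_ideal_diff_iff)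
  have iso_kstar: "Aut_subgroup q (isotropy q ?I) \<cong> (kstar :: 'k monoid)"
    if c: "w = xy_sum q c" and diag: "w = (\<Oplus>\<^bsub>qweyl q\<^esub> i\<in>{i. (i, i) \<in> Poly_Mapping.keys c}.
                   smul q (Poly_Mapping.lookup c (i, i))
                     (Rx q [^]\<^bsub>qweyl q\<^esub> i \<otimes>\<^bsub>qweyl q\<^esub> Ry q [^]\<^bsub>qweyl q\<^esub> i))" for c
  proof -
    let ?K = "{i. (i, i) \<in> Poly_Mapping.keys c}"
    have fin: "finite ?K"
      by (rule finite_subset[of _ "fst ` Poly_Mapping.keys c"]) force+
    have "xy_sum q c = qcls q (\<Sum>i\<in>?K. free_const (Poly_Mapping.lookup c (i, i)) * qmonom (i, i))"
      using diag unfolding c by (simp add: Rx_def Ry_def qcls_finsum[OF fin] qmonom_def)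
    then have eq: "nf q (from_coeffs c) = nf q (\<Sum>i\<in>?K. free_const (Poly_Mapping.lookup c (i, i)) * qmonom (i, i))"
      by (simp only: xy_sum_qcls qcls_eq_iff)
    \<comment> \<open>Monomials are independent, so equality with the diagonal sum forces the
      off-diagonal coefficients of \<open>c\<close> to vanish.\<close>
    have "Poly_Mapping.lookup c (i, j) = 0" if "i \<noteq> j" for i j
    proof -
      have "nf q (\<Sum>i\<in>?K. free_const (Poly_Mapping.lookup c (i, i)) * qmonom (i, i)) (i, j) = 0"
        unfolding nf_sum by (rule sum.neutral) (use that in \<open>auto simp: nf_scale nf_monom\<close>)
      then show ?thesis using fun_cong[OF eq, of "(i, j)"] by (simp only: nf_from_coeffs)
    qed
    then have "\<beta> ^ gcd_S c = 1" if "\<beta> \<noteq> 0" for \<beta> :: 'k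
      unfolding power_gcd_S_eq_1_iff[OF that]
      by (metis diff_self power_int_0_right)
    then have "isotropy q ?I = rho q ` {\<beta>. \<beta> \<noteq> 0}"
      unfolding iso_I'[OF c] by (intro arg_cong[of _ _ "\<lambda>B. rho q ` B"]) blast
    then show ?thesis using rho_group_iso_kstar[of q] by simp
  qed
  have iso_cyclic: "Aut_subgroup q (isotropy q ?I) \<cong> integer_mod_group (gcd_S c)"
    if c: "w = xy_sum q c" and n: "gcd_S c \<notin> {0, 1}" for c
  proof -
    have "{\<beta>. \<beta> \<noteq> 0 \<and> \<beta> ^ gcd_S c = 1} = {\<beta>::'k. \<beta> ^ gcd_S c = 1}"
      using n by (auto simp: power_0_left)
    then show ?thesis unfolding iso_I'[OF c] using rho_group_iso_cyclic[of "gcd_S c" q] n by simp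
  qed
  have iso_trivial: "Aut_subgroup q (isotropy q ?I) \<cong> Aut_subgroup q {Id_R q}"
    if c: "w = xy_sum q c" and n: "gcd_S c = 1" for c
  proof -
    have "{\<beta>. \<beta> \<noteq> 0 \<and> \<beta> ^ gcd_S c = 1} = {1::'k}"
      using n by auto
    then have "isotropy q ?I = {Id_R q}" unfolding iso_I'[OF c] by (simp add: rho_1)
    then show ?thesis by simp
  qed
  show ?thesis
    by (intro conjI allI impI; (elim conjE)?;
        rule split split_nonzero eta_Aut gens cyclic_P normal_form iso_I
          iso_kstar iso_cyclic iso_trivial main; assumption)
qed

end
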